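(* Let $A$ be an expanding integer $n\times n$ matrix, let $D_1,D_2\subset\mathbb{Z}^n$ be different nonempty finite subsets, and let $T_1=T(A,D_1)$ and $T_2=T(A,D_2)$ be the associated self-affine sets. Let $E\subset\mathbb{Z}^n$ be a finite set which contains $D_1$, $D_2$, and some coset transversal $C$ for $\mathbb{Z}^n/A(\mathbb{Z}^n)$. Let $\mathcal{N}$ be the nucleus of the graph $\Gamma(A,E)$, let $\mathcal{N}_{D_1},\mathcal{N}_{D_2}$ be the labeled graphs obtained from it, and for a vertex $v$ of $\mathcal{N}$ let $F^{(i)}_v\subset C^{-\omega}$ be the set calculated in the graph $\mathcal{N}_{D_i}$, $i=1,2$, with $\mu$ the uniform Bernoulli measure on $C^{-\omega}$, all as defined in the context. Then \[ \lambda(T_1\cap T_2)=\sum_{v\in\mathcal{N}}\mu\bigl(F^{(1)}_v\cap F^{(2)}_v\bigr), \] where the sum is over all vertices $v$ of $\mathcal{N}$.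
   Context: An integer matrix $A$ is expanding if every eigenvalue of $A$ has modulus greater than $1$. For a finite nonempty set $D\subset\mathbb{Z}^n$, the self-affine set $T(A,D)\subset\mathbb{R}^n$ is the unique nonempty compact set $T$ with $A(T)=\bigcup_{d\in D}(T+d)$; explicitly $T(A,D)=\{\sum_{k=1}^\infty A^{-k}d_k : d_k\in D\}$. $\lambda$ denotes Lebesgue measure on $\mathbb{R}^n$. A coset transversal $C$ for $\mathbb{Z}^n/A(\mathbb{Z}^n)$ is a set containing exactly one representative of each coset. The directed labeled graph $\Gamma(A,E)$ has vertex set $\mathbb{Z}^n$, and for $u,v\in\mathbb{Z}^n$ and $x,y\in E$ there is a directed edge from $u$ to $v$ labeled by $(x,y)$ if and only if $u+x=y+Av$. Its nucleus $\mathcal{N}$ is the subgraph spanned by all (directed) cycles of $\Gamma(A,E)$ and all vertices that can be reached by following directed paths from the cycles; it is a finite graph. For $i=1,2$, the graph $\mathcal{N}_{D_i}$ is obtained from $\mathcal{N}$ (keeping its vertices) by removing every edge whose label is not in $C\times D_i$ and replacing every remaining label $(a,b)$ by $a$. So edges of $\mathcal{N}_{D_i}$ are labeled by elements of $C$. $C^{-\omega}$ is the space of all left-infinite sequences $\ldots x_2x_1$ with $x_i\in C$, with the product topology of discrete sets; $\mu$ is the uniform Bernoulli measure on $C^{-\omega}$, i.e. the product measure with $\mu(x)=1/|C|$ for each $x\in C$. For a vertex $v$ of $\mathcal{N}$, $F^{(i)}_v\subset C^{-\omega}$ is the set of all left-infinite sequences $\ldots x_2x_1$ that can be read along left-infinite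 directed paths $\cdots\xrightarrow{x_3}v_2\xrightarrow{x_2}v_1\xrightarrow{x_1}v$ in $\mathcal{N}_{D_i}$ ending in $v$. These sets are closed, hence measurable. *)

theory Defs
  imports "Graph_Theory.Digraph_Component" "HOL-Probability.Probability"
begin

definition eigenvalue_of :: "'a::field ^ 'n ^ 'n \<Rightarrow> 'a \<Rightarrow> bool" where
  "eigenvalue_of M c \<longleftrightarrow> (\<exists>v. v \<noteq> 0 \<and> M *v v = c *s v)"

definition expanding :: "int ^ 'n ^ 'n \<Rightarrow> bool" where
  "expanding A \<longleftrightarrow>
     (\<forall>c::complex. eigenvalue_of (map_matrix of_int A) c \<longrightarrow> norm c > 1)"

definition real_vec :: "int ^ 'n \<Rightarrow> real ^ 'n" where
  "real_vec v = (\<chi> i. real_of_int (v $ i))"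

text \<open>For expanding \<open>A\<close> and finite nonempty \<open>D\<close> the set below exists and is unique.\<close>

definition self_affine_set :: "int ^ 'n ^ 'n \<Rightarrow> (int ^ 'n) set \<Rightarrow> (real ^ 'n) set" where
  "self_affine_set A D =
     (THE T. T \<noteq> {} \<and> compact T \<and>
        (\<lambda>t. map_matrix real_of_int A *v t) ` T = (\<Union>d\<in>D. (\<lambda>t. t + real_vec d) ` T))"

definition coset_transversal :: "int ^ 'n ^ 'n \<Rightarrow> (int ^ 'n) set \<Rightarrow> bool" where
  "coset_transversal A C \<longleftrightarrow> (\<forall>x. \<exists>!c. c \<in> C \<and> c \<in> range (\<lambda>z. x + A *v z))"

text \<open>A labeled arc is a triple \<open>(source, label, target)\<close>, so that parallel arcs with
  different labels are distinct.\<close>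

definition labeled_digraph ::
  "'v set \<Rightarrow> ('v \<times> 'l \<times> 'v) set \<Rightarrow> ('v, 'v \<times> 'l \<times> 'v) pre_digraph" where
  "labeled_digraph V R =
     \<lparr> verts = V, arcs = R, tail = (\<lambda>(u, l, v). u), head = (\<lambda>(u, l, v). v) \<rparr>"

definition Gamma_graph :: "int ^ 'n ^ 'n \<Rightarrow> (int ^ 'n) set \<Rightarrow>
    (int ^ 'n, (int ^ 'n) \<times> ((int ^ 'n) \<times> (int ^ 'n)) \<times> (int ^ 'n)) pre_digraph" where
  "Gamma_graph A E =
     labeled_digraph UNIV {(u, (x, y), v). x \<in> E \<and> y \<in> E \<and> u + x = y + A *v v}"

text \<open>Loops count as cycles in \<^const>\<open>pre_digraph.cycle\<close>, and \<^const>\<open>reachable\<close> is reflexive,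
  so the cycles themselves belong to the nucleus.\<close>

definition nucleus :: "('v, 'e) pre_digraph \<Rightarrow> ('v, 'e) pre_digraph" where
  "nucleus G = induce_subgraph G
     {v. \<exists>p. pre_digraph.cycle G p \<and> (\<exists>e\<in>set p. reachable G (tail G e) v)}"

definition restrict_labels :: "('v, 'v \<times> ('l \<times> 'm) \<times> 'v) pre_digraph \<Rightarrow> 'l set \<Rightarrow> 'm set \<Rightarrow>
    ('v, 'v \<times> 'l \<times> 'v) pre_digraph" where
  "restrict_labels G C D = labeled_digraph (verts G)
     {(u, a, v). a \<in> C \<and> (\<exists>b\<in>D. (u, (a, b), v) \<in> arcs G)}"

text \<open>A left-infinite sequence \<open>\<dots> x\<^sub>2 x\<^sub>1\<close> is represented by \<open>x :: nat \<Rightarrow> 'l\<close> with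
  \<open>x k\<close> standing for \<open>x\<^sub>k\<^sub>+\<^sub>1\<close>. Similarly \<open>w k\<close> is \<open>v\<^sub>k\<close>, and \<open>w 0\<close> is the end vertex.\<close>

definition left_infinite_labels ::
  "('v, 'v \<times> 'l \<times> 'v) pre_digraph \<Rightarrow> 'v \<Rightarrow> (nat \<Rightarrow> 'l) set" where
  "left_infinite_labels G v =
     {x. \<exists>w. w 0 = v \<and> (\<forall>k. (w (Suc k), x k, w k) \<in> arcs G)}"

definition bernoulli_measure :: "'l set \<Rightarrow> (nat \<Rightarrow> 'l) measure" where
  "bernoulli_measure C = Pi\<^sub>M UNIV (\<lambda>_. uniform_count_measure C)"

end

theory Submission
  imports Defs "HOL-Computational_Algebra.Fundamental_Theorem_Algebra"
begin

text \<open>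
  Let \<open>value_of x = A\<^sup>-\<^sup>1 x\<^sub>1 + A\<^sup>-\<^sup>2 x\<^sub>2 + \<dots>\<close>. An edge \<open>u \<rightarrow> v\<close> with label \<open>(x, y)\<close> says
  \<open>v = A\<^sup>-\<^sup>1 (x - y + u)\<close>. Hence a left-infinite path with finitely many vertices ends in
  \<open>v = value_of x - value_of y\<close>, and conversely any integer vector of this form is the end of such a path.
  The vertices of the nucleus are exactly the ends of such paths, so a sequence \<open>x\<close> over \<open>C\<close> can be read
  into \<open>v\<close> with second labels in \<open>D\<close> if and only if \<open>value_of x - v\<close> lies in the self-affine set of \<open>D\<close>
  (\<open>left_infinite_labels_nucleus\<close>). The right-hand side of the theorem is thus the sum of
  \<open>\<mu> {x. value_of x - v \<in> T\<^sub>1 \<inter> T\<^sub>2}\<close>, which may be taken over all \<open>v\<close> in \<open>\<int>\<^sup>n\<close>.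

  It remains to see that \<open>\<Sum>\<^sub>v \<mu> {x. value_of x - v \<in> T}\<close> is the Lebesgue measure of \<open>T\<close>
  (\<open>translates_measure_eq_lborel\<close>). As a function of \<open>T\<close> this sum is a measure \<open>\<rho>\<close>, invariant under
  \<open>\<int>\<^sup>n\<close>. Because \<open>C\<close> is a transversal, \<open>\<rho>\<close> is self-similar under \<open>A\<close>
  (\<open>translates_measure_self_similar\<close>), which upgrades the invariance to all vectors \<open>A\<^sup>-\<^sup>k u\<close> with \<open>u\<close>
  integral. These vectors are dense, so the masses of open sets are invariant under all translations. Finally,
  averaging over the translations in a unit cell gives Lebesgue measure by Fubini's theorem, whatever the
  digit distribution is (\<open>translates_measure_average\<close>).

  Convergence of all the series rests on the geometric decay of \<open>A\<^sup>-\<^sup>k\<close>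
  (\<open>expanding_inverse_contracts\<close>), derived from the eigenvalue condition by induction on the degree of
  an annihilating polynomial.
\<close>

section \<open>Backward orbits of an expanding matrix decay geometrically\<close>

definition decays_geometrically :: "(nat \<Rightarrow> 'a::real_normed_vector) \<Rightarrow> bool" where
  "decays_geometrically z \<longleftrightarrow> (\<exists>K r. 0 \<le> r \<and> r < 1 \<and> (\<forall>k. norm (z k) \<le> K * r ^ k))"

lemma geometric_decay_of_recursive_bound:
  fixes a :: "nat \<Rightarrow> real"
  assumes a: "\<And>k. a (Suc k) \<le> q * a k + K * r ^ k" and a0: "0 \<le> a 0"
    and q: "0 \<le> q" "q < 1" and r: "0 \<le> r" "r < 1" and K: "0 \<le> K"
  shows "\<exists>L s. 0 \<le> s \<and> s < 1 \<and> (\<forall>k. a k \<le> L * s ^ k)"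
proof -
  \<comment> \<open>Any rate strictly above both \<open>q\<close> and \<open>r\<close> works; the strict gap \<open>s - q\<close> absorbs the
    forcing term even when \<open>q = r\<close>.\<close>
  obtain s where s: "max q r < s" "s < 1"
    using dense[of "max q r" 1] q r by auto
  define L where "L = a 0 + K / (s - q)"
  have L: "K \<le> (s - q) * L"
  proof -
    have "(s - q) * L = (s - q) * a 0 + K" using s by (simp add: L_def distrib_left)
    moreover have "0 \<le> (s - q) * a 0" using s a0 by simp
    ultimately show ?thesis by linarith
  qed
  have "a k \<le> L * s ^ k" for k
  proof (induction k)
    case 0
    show ?case using s K by (simp add: L_def)
  next
    case (Suc k)
    have rs: "r ^ k \<le> s ^ k" using s r by (intro power_mono) auto
    have "a (Suc k) \<le> q * a k + K * r ^ k" by (rule a)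
    also have "\<dots> \<le> q * (L * s ^ k) + (s - q) * L * s ^ k"
    proof (rule add_mono)
      show "q * a k \<le> q * (L * s ^ k)" using Suc q(1) by (rule mult_left_mono)
      have "K * r ^ k \<le> K * s ^ k" using rs K by (rule mult_left_mono)
      also have "\<dots> \<le> (s - q) * L * s ^ k" using L s q by (intro mult_right_mono) auto
      finally show "K * r ^ k \<le> (s - q) * L * s ^ k" .
    qed
    also have "\<dots> = L * s ^ Suc k" by (simp add: algebra_simps)
    finally show ?case .
  qed
  then show ?thesis using s q by (intro exI[of _ L] exI[of _ s]) auto
qed

definition poly_act :: "'a::field poly \<Rightarrow> 'a ^ 'n ^ 'n \<Rightarrow> 'a ^ 'n \<Rightarrow> 'a ^ 'n" where
  "poly_act p M v = (\<Sum>i\<le>degree p. coeff p i *s ((*v) M ^^ i) v)"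

lemma poly_act_eq_sum_atMost:
  assumes "degree p \<le> N"
  shows "poly_act p M v = (\<Sum>i\<le>N. coeff p i *s ((*v) M ^^ i) v)"
  unfolding poly_act_def
  using assms by (intro sum.mono_neutral_left) (auto simp: coeff_eq_0)

lemma funpow_matrix_diff:
  fixes M :: "'a::field ^ 'n ^ 'n"
  shows "((*v) M ^^ i) (x - c *s y) = ((*v) M ^^ i) x - c *s ((*v) M ^^ i) y"
  by (induction i) (auto simp: matrix_vector_mult_diff_distrib vector_scalar_commute)

lemma poly_act_linear_factor:
  fixes M :: "'a::field ^ 'n ^ 'n"
  shows "poly_act ([:-c, 1:] * q) M v = poly_act q M (M *v v - c *s v)"
proof -
  let ?N = "Suc (degree q)"
  have deg: "degree ([:-c, 1:] * q) \<le> ?N"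
    using degree_mult_le[of "[:-c, 1:]" q] by (simp split: if_splits)
  have "poly_act ([:-c, 1:] * q) M v
      = (\<Sum>i\<le>?N. (coeff (pCons 0 q) i - c * coeff q i) *s ((*v) M ^^ i) v)"
    by (subst poly_act_eq_sum_atMost[OF deg]) simp
  also have "\<dots> = (\<Sum>i\<le>?N. coeff (pCons 0 q) i *s ((*v) M ^^ i) v)
      - c *s (\<Sum>i\<le>?N. coeff q i *s ((*v) M ^^ i) v)"
    by (simp add: vector_sub_rdistrib sum_subtractf vector_scalar_mult_def vec_eq_iff
        sum_distrib_left algebra_simps del: sum.atMost_Suc)
  also have "(\<Sum>i\<le>?N. coeff (pCons 0 q) i *s ((*v) M ^^ i) v)
      = (\<Sum>i\<le>degree q. coeff q i *s ((*v) M ^^ i) (M *v v))"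
    by (subst sum.atMost_Suc_shift) (simp add: funpow_swap1)
  also have "(\<Sum>i\<le>?N. coeff q i *s ((*v) M ^^ i) v) = (\<Sum>i\<le>degree q. coeff q i *s ((*v) M ^^ i) v)"
    by (simp add: coeff_eq_0)
  finally show ?thesis
    by (simp add: poly_act_def funpow_matrix_diff sum_subtractf vec_eq_iff
        sum_distrib_left algebra_simps)
qed

lemma poly_act_commute:
  fixes M :: "'a::field ^ 'n ^ 'n"
  shows "poly_act q M (M *v v - c *s v) = M *v poly_act q M v - c *s poly_act q M v"
proof -
  have "M *v poly_act q M v = (\<Sum>i\<le>degree q. coeff q i *s ((*v) M ^^ i) (M *v v))"
    unfolding poly_act_def
    by (simp add: vec.linear_sum[OF matrix_vector_mul_linear_gen] vector_scalar_commute funpow_swap1)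
  then show ?thesis
    by (simp add: poly_act_def funpow_matrix_diff sum_subtractf vec_eq_iff
        sum_distrib_left algebra_simps)
qed

lemma norm_scalar_mult_complex:
  fixes z :: "complex ^ 'n"
  shows "norm (c *s z) = norm c * norm z"
  by (simp add: norm_vec_def norm_mult L2_set_right_distrib)

text \<open>A backward orbit is a sequence with \<open>M z\<^sub>k\<^sub>+\<^sub>1 = z\<^sub>k\<close>. The degree of an annihilating polynomial is
  lowered by splitting off a root \<open>c\<close>: the sequence \<open>u\<^sub>k = M z\<^sub>k - c z\<^sub>k\<close> is a backward orbit annihilated
  by the cofactor. If \<open>c\<close> is an eigenvalue, then \<open>c z\<^sub>k\<^sub>+\<^sub>1 = z\<^sub>k - u\<^sub>k\<^sub>+\<^sub>1\<close> turns decay of \<open>u\<close> into decay of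
  \<open>z\<close>, as \<open>c\<close> has modulus above \<open>1\<close>. If not, \<open>M - c\<close> is injective and the cofactor already annihilates \<open>z\<close>.\<close>

lemma backward_orbit_decay:
  fixes M :: "complex ^ 'n ^ 'n"
  assumes ev: "\<And>c. eigenvalue_of M c \<Longrightarrow> norm c > 1"
    and "p \<noteq> 0" "\<And>k. M *v z (Suc k) = z k" "\<And>k. poly_act p M (z k) = 0"
  shows "decays_geometrically z"
  using assms(2-)
proof (induction "degree p" arbitrary: p z)
  case 0
  then obtain a where p: "p = [:a:]" "a \<noteq> 0"
    by (metis degree_eq_zeroE pCons_eq_0_iff)
  then have "z k = 0" for k
    using 0(4)[of k] by (simp add: poly_act_def)
  then show ?case
    unfolding decays_geometrically_def by (intro exI[of _ 0]) auto
next
  case (Suc d)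
  have "\<not> (\<exists>a l. a \<noteq> 0 \<and> l = 0 \<and> p = pCons a l)"
    using Suc.hyps(2) by auto
  then obtain c where "poly p c = 0"
    using fundamental_theorem_of_algebra_alt by blast
  then obtain q where p: "p = [:-c, 1:] * q"
    unfolding poly_eq_0_iff_dvd by (auto elim: dvdE)
  have q0: "q \<noteq> 0" using Suc.prems(1) p by auto
  have dq: "d = degree q"
    using Suc.hyps(2) q0 by (simp add: p degree_mult_eq del: mult_pCons_left)
  let ?u = "\<lambda>k. M *v z k - c *s z k"
  have qu: "poly_act q M (?u k) = 0" for k
    using Suc.prems(3)[of k] by (simp only: p poly_act_linear_factor)
  have u: "decays_geometrically ?u"
  proof (rule Suc.hyps(1)[OF dq q0 _ qu])
    show "M *v ?u (Suc k) = ?u k" for k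
      using Suc.prems(2) by (simp add: matrix_vector_mult_diff_distrib vector_scalar_commute)
  qed
  show ?case
  proof (cases "eigenvalue_of M c")
    case True
    then have c: "norm c > 1" by (rule ev)
    obtain K r where r: "0 \<le> r" "r < 1" and K: "\<And>k. norm (?u k) \<le> K * r ^ k"
      using u unfolding decays_geometrically_def by blast
    have K0: "0 \<le> K" using K[of 0] norm_ge_zero[of "?u 0"] by (simp del: norm_ge_zero)
    have step: "norm (z (Suc k)) \<le> inverse (norm c) * norm (z k) + K * r ^ k" for k
    proof -
      have "c *s z (Suc k) = z k - ?u (Suc k)" using Suc.prems(2)[of k] by simp
      then have "norm c * norm (z (Suc k)) = norm (z k - ?u (Suc k))"
        by (metis norm_scalar_mult_complex)
      also have "\<dots> \<le> norm (z k) + norm (?u (Suc k))" by (rule norm_triangle_ineq4)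
      also have "\<dots> \<le> norm (z k) + K * r ^ k"
      proof -
        have "K * r ^ Suc k \<le> K * r ^ k"
          using K0 r by (intro mult_left_mono power_decreasing) auto
        then show ?thesis using K[of "Suc k"] by linarith
      qed
      finally have "norm c * norm (z (Suc k)) \<le> norm (z k) + K * r ^ k" .
      then have "norm (z (Suc k)) \<le> (norm (z k) + K * r ^ k) / norm c"
        using c by (subst pos_le_divide_eq) (auto simp: mult.commute)
      also have "\<dots> = inverse (norm c) * norm (z k) + inverse (norm c) * (K * r ^ k)"
        by (simp add: divide_inverse algebra_simps)
      also have "inverse (norm c) * (K * r ^ k) \<le> 1 * (K * r ^ k)"
        using c K0 r by (intro mult_right_mono) (auto simp: inverse_le_1_iff)
      finally show ?thesis by simp
    qed
    have "\<exists>L s. 0 \<le> s \<and> s < 1 \<and> (\<forall>k. norm (z k) \<le> L * s ^ k)"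
      using c by (intro geometric_decay_of_recursive_bound[OF step _ _ _ r K0])
        (auto simp: inverse_less_1_iff)
    then show ?thesis by (simp add: decays_geometrically_def)
  next
    case False
    have "poly_act q M (z k) = 0" for k
    proof -
      have "M *v poly_act q M (z k) = c *s poly_act q M (z k)"
        using qu[of k] by (simp add: poly_act_commute)
      with False show ?thesis unfolding eigenvalue_of_def by blast
    qed
    then show ?thesis
      using Suc.hyps(1)[where z = z, OF dq q0] Suc.prems(2) by blast
  qed
qed

text \<open>The powers of \<open>M\<close> lie in a finite-dimensional real vector space, so finitely many of them are
  linearly dependent.\<close>

lemma annihilating_poly_exists:
  fixes M :: "complex ^ 'n ^ 'n"
  obtains p where "p \<noteq> 0" "\<And>v. poly_act p M v = 0"
proof -
  let ?N = "DIM(complex ^ 'n ^ 'n)"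
  define P where "P = (\<lambda>i. ((**) M ^^ i) (mat 1))"
  have P: "P i *v v = ((*v) M ^^ i) v" for i v
    by (induction i) (auto simp: P_def matrix_vector_mul_assoc[symmetric])
  obtain a :: "nat \<Rightarrow> real" and j
    where j: "j \<le> ?N" "a j \<noteq> 0" and a: "(\<Sum>i\<le>?N. a i *\<^sub>R P i) = 0"
  proof (cases "inj_on P {..?N}")
    case True
    then have "dependent (P ` {..?N})"
      by (intro dependent_biggerset) (simp add: card_image)
    then obtain u where u: "\<exists>v\<in>P ` {..?N}. u v \<noteq> 0" "(\<Sum>v\<in>P ` {..?N}. u v *\<^sub>R v) = 0"
      by (subst (asm) dependent_finite) auto
    then obtain j where "j \<le> ?N" "u (P j) \<noteq> 0" by blast
    moreover have "(\<Sum>i\<le>?N. u (P i) *\<^sub>R P i) = 0"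
      using u(2) by (subst (asm) sum.reindex[OF True]) (simp add: o_def)
    ultimately show ?thesis by (rule that)
  next
    case False
    then obtain i k where ik: "i \<le> ?N" "k \<le> ?N" "i \<noteq> k" "P i = P k"
      by (auto simp: inj_on_def)
    let ?a = "\<lambda>l. (if l = i then 1 else 0) - (if l = k then 1 else 0) :: real"
    have "(\<Sum>l\<le>?N. ?a l *\<^sub>R P l)
        = (\<Sum>l\<le>?N. if l = i then P l else 0) - (\<Sum>l\<le>?N. if l = k then P l else 0)"
      unfolding sum_subtractf[symmetric] by (intro sum.cong) (auto simp: algebra_simps)
    also have "\<dots> = 0" using ik by simp
    finally show ?thesis using that[of i ?a] ik by simp
  qed
  define p where "p = (\<Sum>i\<le>?N. monom (complex_of_real (a i)) i)"
  have coeff_p: "coeff p i = (if i \<le> ?N then complex_of_real (a i) else 0)" for i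
    by (simp add: p_def coeff_sum)
  have "coeff p j \<noteq> 0" using j by (simp add: coeff_p)
  then have "p \<noteq> 0" by auto
  moreover have "poly_act p M v = 0" for v
  proof -
    have "degree p \<le> ?N" by (intro degree_le) (simp add: coeff_p)
    then have "poly_act p M v = (\<Sum>i\<le>?N. coeff p i *s ((*v) M ^^ i) v)"
      by (rule poly_act_eq_sum_atMost)
    also have "\<dots> = (\<Sum>i\<le>?N. (a i *\<^sub>R P i) *v v)"
      by (intro sum.cong refl)
        (simp add: coeff_p P[symmetric] matrix_vector_mult_def vec_eq_iff scaleR_sum_right
          scaleR_conv_of_real[where 'a = complex] sum_distrib_left mult.assoc)
    also have "\<dots> = (\<Sum>i\<le>?N. a i *\<^sub>R P i) *v v"
    proof -
      have "(\<Sum>i\<le>m. (a i *\<^sub>R P i) *v v) = (\<Sum>i\<le>m. a i *\<^sub>R P i) *v v" for m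
        by (induction m) (auto simp: matrix_vector_mult_add_rdistrib)
      then show ?thesis .
    qed
    finally show ?thesis unfolding a by simp
  qed
  ultimately show ?thesis by (rule that)
qed

lemma linear_matrix_funpow:
  fixes B :: "real ^ 'n ^ 'n"
  shows "linear ((*v) B ^^ k)"
  by (induction k)
    (auto simp: id_def[symmetric] linear_id intro: linear_compose[where g = "(*v) B", unfolded o_def])

definition complex_vec :: "real ^ 'n \<Rightarrow> complex ^ 'n" where
  "complex_vec x = (\<chi> i. complex_of_real (x $ i))"

lemma norm_complex_vec [simp]: "norm (complex_vec x) = norm x"
  by (simp add: complex_vec_def norm_vec_def)

lemma complex_matrix_mult_complex_vec:
  fixes A :: "int ^ 'n ^ 'n"
  shows "map_matrix of_int A *v complex_vec x = complex_vec (map_matrix real_of_int A *v x)"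
  by (simp add: complex_vec_def matrix_vector_mult_def vec_eq_iff)

text \<open>The eigenvalue condition concerns complex vectors, while the contraction estimate is needed for real
  ones. Orbits of real basis vectors under the inverse are complex backward orbits of \<open>A\<close>, and their
  finitely many decay rates are replaced by the largest.\<close>

lemma expanding_inverse_contracts:
  fixes A :: "int ^ 'n ^ 'n"
  assumes "expanding A"
  obtains B :: "real ^ 'n ^ 'n" and K r where
    "map_matrix real_of_int A ** B = mat 1" "B ** map_matrix real_of_int A = mat 1"
    "0 \<le> r" "r < 1" "\<And>k x. norm (((*v) B ^^ k) x) \<le> K * r ^ k * norm x"
proof -
  let ?A = "map_matrix real_of_int A" and ?M = "map_matrix of_int A :: complex ^ 'n ^ 'n"
  have ev: "norm c > 1" if "eigenvalue_of ?M c" for c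
    using assms that by (simp add: expanding_def)
  have "x = 0" if "?A *v x = 0" for x
  proof (rule ccontr)
    assume "x \<noteq> 0"
    then have "complex_vec x \<noteq> 0" by (metis norm_complex_vec norm_eq_zero)
    moreover have "?M *v complex_vec x = 0 *s complex_vec x"
      by (simp add: complex_matrix_mult_complex_vec that) (simp add: complex_vec_def vec_eq_iff)
    ultimately have "eigenvalue_of ?M 0" unfolding eigenvalue_of_def by blast
    from ev[OF this] show False by simp
  qed
  then obtain B where BA: "B ** ?A = mat 1"
    using matrix_left_invertible_ker by blast
  then have AB: "?A ** B = mat 1" by (simp add: matrix_left_right_inverse)
  obtain p where p: "p \<noteq> 0" "\<And>v. poly_act p ?M v = 0"
    using annihilating_poly_exists by blast
  let ?z = "\<lambda>x k. complex_vec (((*v) B ^^ k) x)"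
  have "decays_geometrically (?z x)" for x
    by (rule backward_orbit_decay[OF ev p(1) _ p(2)])
      (auto simp: complex_matrix_mult_complex_vec matrix_vector_mul_assoc AB)
  then have "\<forall>i. \<exists>K r. 0 \<le> r \<and> r < 1 \<and> (\<forall>k. norm (((*v) B ^^ k) (axis i 1)) \<le> K * r ^ k)"
    by (simp add: decays_geometrically_def)
  then obtain K r where r: "\<And>i. 0 \<le> r i" "\<And>i. r i < 1"
    and K: "\<And>i k. norm (((*v) B ^^ k) (axis i 1)) \<le> K i * r i ^ k"
    by metis
  define R where "R = Max (range r)"
  have R: "r i \<le> R" "0 \<le> R" "R < 1" for i
    using r by (auto simp: R_def Max_ge_iff intro: Max_ge)
  have K0: "0 \<le> K i" for i
    using order_trans[OF norm_ge_zero K[of 0 i]] by simp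
  have "norm (((*v) B ^^ k) x) \<le> (\<Sum>i\<in>UNIV. K i) * R ^ k * norm x" for k x
  proof -
    note lin = linear_matrix_funpow[of k B]
    have "x = (\<Sum>i\<in>UNIV. x $ i *\<^sub>R axis i 1)"
      using basis_expansion[of x] by (simp add: scalar_mult_eq_scaleR)
    then have "((*v) B ^^ k) x = ((*v) B ^^ k) (\<Sum>i\<in>UNIV. x $ i *\<^sub>R axis i 1)"
      by (rule arg_cong)
    also have "\<dots> = (\<Sum>i\<in>UNIV. x $ i *\<^sub>R ((*v) B ^^ k) (axis i 1))"
      by (simp add: linear_sum[OF lin] linear_scale[OF lin])
    also have "norm \<dots> \<le> (\<Sum>i\<in>UNIV. K i * R ^ k * norm x)"
    proof (rule sum_norm_le)
      fix i
      have "norm (x $ i *\<^sub>R ((*v) B ^^ k) (axis i 1)) \<le> norm x * (K i * r i ^ k)"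
        using K[of k i] component_le_norm_cart[of x i] by (simp add: mult_mono)
      also have "\<dots> \<le> norm x * (K i * R ^ k)"
        using K0[of i] R r by (intro mult_left_mono power_mono) auto
      finally show "norm (x $ i *\<^sub>R ((*v) B ^^ k) (axis i 1)) \<le> K i * R ^ k * norm x"
        by (simp add: algebra_simps)
    qed
    finally show ?thesis by (simp add: sum_distrib_right)
  qed
  then show ?thesis using that AB BA R by blast
qed

section \<open>Radix expansions and self-affine sets\<close>

lemma real_vec_add: "real_vec (u + v) = real_vec u + real_vec v"
  and real_vec_diff: "real_vec (u - v) = real_vec u - real_vec v"
  and real_vec_matrix_mult: "real_vec (A *v u) = map_matrix real_of_int A *v real_vec u"
  and inj_real_vec: "inj real_vec"
  by (auto simp: real_vec_def vec_eq_iff matrix_vector_mult_def inj_def)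

lemma compact_Pi_UNIV:
  fixes S :: "'a::topological_space set"
  assumes "compact S"
  shows "compact (UNIV \<rightarrow> S)"
proof -
  have "compactin (product_topology (\<lambda>_. euclidean) UNIV) (PiE UNIV (\<lambda>_::'b. S))"
    using assms by (subst compactin_PiE) auto
  then show ?thesis
    by (simp add: euclidean_product_topology compactin_euclidean_iff PiE_UNIV_domain)
qed

locale contracting_inverse =
  fixes A :: "int ^ 'n ^ 'n" and B :: "real ^ 'n ^ 'n" and K r :: real
  assumes AB: "map_matrix real_of_int A ** B = mat 1"
    and BA: "B ** map_matrix real_of_int A = mat 1"
    and r: "0 \<le> r" "r < 1"
    and contracts: "\<And>k x. norm (((*v) B ^^ k) x) \<le> K * r ^ k * norm x"
begin

abbreviation A\<^sub>R :: "real ^ 'n ^ 'n" where "A\<^sub>R \<equiv> map_matrix real_of_int A"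

text \<open>The point with digits \<open>y\<^sub>0, y\<^sub>1, \<dots>\<close> after the radix point, in base \<open>A\<close>.\<close>

definition expansion :: "(nat \<Rightarrow> real ^ 'n) \<Rightarrow> real ^ 'n" where
  "expansion y = (\<Sum>k. ((*v) B ^^ Suc k) (y k))"

abbreviation value_of :: "(nat \<Rightarrow> int ^ 'n) \<Rightarrow> real ^ 'n" where
  "value_of x \<equiv> expansion (\<lambda>k. real_vec (x k))"

lemma A_B [simp]: "A\<^sub>R *v (B *v x) = x" and B_A [simp]: "B *v (A\<^sub>R *v x) = x"
  by (simp_all add: matrix_vector_mul_assoc AB BA)

lemma K_nonneg: "0 \<le> K"
  using order_trans[OF norm_ge_zero contracts[of 0 "axis undefined 1"]] by simp

lemma norm_expansion_term:
  assumes "norm x \<le> c"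
  shows "norm (((*v) B ^^ Suc k) x) \<le> K * c * r ^ k"
proof -
  have c: "0 \<le> c" using assms norm_ge_zero order_trans by blast
  have "norm (((*v) B ^^ Suc k) x) \<le> K * r ^ Suc k * norm x" by (rule contracts)
  also have "\<dots> \<le> K * r ^ k * c"
    using K_nonneg r assms c by (intro mult_mono mult_left_mono power_decreasing) auto
  finally show ?thesis by (simp add: algebra_simps)
qed

lemma summable_expansion_bound: "summable (\<lambda>k. K * c * r ^ k)"
  using r by (intro summable_mult summable_geometric) auto

lemma summable_expansion:
  assumes "\<And>k. norm (y k) \<le> c"
  shows "summable (\<lambda>k. norm (((*v) B ^^ Suc k) (y k)))"
proof (rule summable_comparison_test'[OF summable_expansion_bound[of c], of 0])
  show "norm (norm (((*v) B ^^ Suc k) (y k))) \<le> K * c * r ^ k" for k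
    unfolding real_norm_def abs_norm_cancel by (rule norm_expansion_term[OF assms])
qed

lemma norm_expansion_le:
  assumes "\<And>k. norm (y k) \<le> c"
  shows "norm (expansion y) \<le> K * c / (1 - r)"
proof -
  have "norm (expansion y) \<le> (\<Sum>k. norm (((*v) B ^^ Suc k) (y k)))"
    unfolding expansion_def by (rule summable_norm[OF summable_expansion[OF assms]])
  also have "\<dots> \<le> (\<Sum>k. K * c * r ^ k)"
    by (intro suminf_le norm_expansion_term assms summable_expansion[OF assms]
        summable_expansion_bound)
  also have "\<dots> = K * c / (1 - r)"
    using r by (simp add: suminf_mult suminf_geometric)
  finally show ?thesis .
qed

lemma expansion_unfold:
  assumes "\<And>k. norm (y k) \<le> c"
  shows "expansion y = B *v (y 0 + expansion (\<lambda>k. y (Suc k)))"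
proof -
  have s: "summable (\<lambda>k. ((*v) B ^^ Suc k) (y k))"
    and s': "summable (\<lambda>k. ((*v) B ^^ Suc k) (y (Suc k)))"
    by (rule summable_norm_cancel, rule summable_expansion, rule assms)+
  have "expansion y = B *v y 0 + (\<Sum>k. ((*v) B ^^ Suc (Suc k)) (y (Suc k)))"
    unfolding expansion_def using suminf_split_head[OF s] by simp
  also have "(\<Sum>k. ((*v) B ^^ Suc (Suc k)) (y (Suc k))) = (\<Sum>k. B *v ((*v) B ^^ Suc k) (y (Suc k)))"
    by simp
  also have "\<dots> = B *v (\<Sum>k. ((*v) B ^^ Suc k) (y (Suc k)))"
    by (rule bounded_linear.suminf[OF matrix_vector_mul_bounded_linear s', symmetric])
  finally show ?thesis
    by (simp add: expansion_def matrix_vector_right_distrib)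
qed

lemma expansion_diff:
  assumes "\<And>k. norm (x k) \<le> c" "\<And>k. norm (y k) \<le> d"
  shows "expansion (\<lambda>k. x k - y k) = expansion x - expansion y"
  using suminf_diff[OF summable_norm_cancel[OF summable_expansion[OF assms(1)]]
      summable_norm_cancel[OF summable_expansion[OF assms(2)]]]
  by (simp add: expansion_def linear_diff[OF linear_matrix_funpow] matrix_vector_mult_diff_distrib)

text \<open>The difference of \<open>w\<^sub>k\<close> and the expansion of the digits from position \<open>k\<close> on is a bounded backward
  orbit of the homogeneous recursion, hence zero by contraction. The lemma serves twice: for
  uniqueness of the self-affine set and for reading off the end vertex of an infinite path.\<close>

lemma bounded_backward_orbit:
  assumes w: "\<And>k. w k = B *v (y k + w (Suc k))"
    and y: "\<And>k. norm (y k) \<le> c" and c': "\<And>k. norm (w k) \<le> c'"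
  shows "w 0 = expansion y"
proof -
  let ?e = "\<lambda>k. w k - expansion (\<lambda>j. y (k + j))"
  have step: "?e k = B *v ?e (Suc k)" for k
    by (subst w, subst expansion_unfold[of _ c])
      (auto simp: y matrix_vector_mult_diff_distrib matrix_vector_right_distrib)
  have e0: "?e 0 = ((*v) B ^^ k) (?e k)" for k
  proof (induction k)
    case (Suc k)
    then show ?case using step[of k] by (simp add: funpow_swap1)
  qed simp
  let ?b = "c' + K * c / (1 - r)"
  have "norm (?e 0) \<le> K * r ^ k * ?b" for k
  proof -
    have "norm (?e k) \<le> ?b"
      by (rule order_trans[OF norm_triangle_ineq4] add_mono c' norm_expansion_le y)+
    then have "K * r ^ k * norm (?e k) \<le> K * r ^ k * ?b"
      using K_nonneg r by (intro mult_left_mono) auto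
    then show ?thesis using contracts[of k "?e k"] e0[of k] by simp
  qed
  moreover have "(\<lambda>k. K * r ^ k * ?b) \<longlonglongrightarrow> K * 0 * ?b"
    using r by (intro tendsto_intros LIMSEQ_power_zero) auto
  ultimately have "norm (?e 0) \<le> K * 0 * ?b"
    by (intro LIMSEQ_le_const[of _ _ "norm (?e 0)"]) auto
  then show ?thesis by simp
qed

lemma continuous_on_expansion:
  assumes "bounded S"
  shows "continuous_on (UNIV \<rightarrow> S) expansion"
proof -
  obtain c where c: "\<And>x. x \<in> S \<Longrightarrow> norm x \<le> c"
    using assms by (auto simp: bounded_iff)
  have "uniform_limit (UNIV \<rightarrow> S) (\<lambda>n y. \<Sum>k<n. ((*v) B ^^ Suc k) (y k)) expansion sequentially"
    unfolding expansion_def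
  proof (rule Weierstrass_m_test[OF _ summable_expansion_bound])
    show "norm (((*v) B ^^ Suc k) (y k)) \<le> K * c * r ^ k" if "y \<in> UNIV \<rightarrow> S" for k y
      using that by (intro norm_expansion_term c) auto
  qed
  moreover have "continuous_on (UNIV \<rightarrow> S) (\<lambda>y. ((*v) B ^^ Suc k) (y k))" for k
    by (rule continuous_on_compose2[OF
          linear_continuous_on[OF linear_matrix_funpow[unfolded linear_conv_bounded_linear]]
          continuous_on_subset[OF continuous_on_product_coordinates]]) auto
  ultimately show ?thesis
    by (intro uniform_limit_theorem[where F = sequentially]) (auto intro!: always_eventually continuous_on_sum)
qed

definition expansions :: "(real ^ 'n) set \<Rightarrow> (real ^ 'n) set" where
  "expansions S = expansion ` (UNIV \<rightarrow> S)"

lemma compact_expansions: "compact S \<Longrightarrow> compact (expansions S)"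
  unfolding expansions_def
  by (intro compact_continuous_image continuous_on_expansion compact_Pi_UNIV compact_imp_bounded)

lemma expansions_self_affine:
  assumes "bounded S"
  shows "(*v) A\<^sub>R ` expansions S = (\<Union>d\<in>S. (\<lambda>t. t + d) ` expansions S)"
proof -
  obtain c where c: "\<And>x. x \<in> S \<Longrightarrow> norm x \<le> c"
    using assms by (auto simp: bounded_iff)
  have unfold: "A\<^sub>R *v expansion y = expansion (\<lambda>k. y (Suc k)) + y 0" if "y \<in> UNIV \<rightarrow> S" for y
    using that c by (subst expansion_unfold[of _ c]) (auto simp: add.commute)
  show ?thesis
  proof (intro set_eqI iffI)
    fix t assume "t \<in> (*v) A\<^sub>R ` expansions S"
    then obtain y where y: "y \<in> UNIV \<rightarrow> S" "t = A\<^sub>R *v expansion y"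
      by (auto simp: expansions_def)
    then show "t \<in> (\<Union>d\<in>S. (\<lambda>t. t + d) ` expansions S)"
      by (auto simp: unfold expansions_def intro!: bexI[of _ "y 0"])
  next
    fix t assume "t \<in> (\<Union>d\<in>S. (\<lambda>t. t + d) ` expansions S)"
    then obtain d y where d: "d \<in> S" and y: "y \<in> UNIV \<rightarrow> S" "t = expansion y + d"
      by (auto simp: expansions_def)
    have "case_nat d y \<in> UNIV \<rightarrow> S" using d y by (auto simp: Pi_iff split: nat.split)
    with unfold[OF this] y show "t \<in> (*v) A\<^sub>R ` expansions S"
      by (auto simp: expansions_def intro!: image_eqI[of _ _ "expansion (case_nat d y)"])
  qed
qed

text \<open>Every point of \<open>T\<close> has an \<open>A\<close>-image of the form \<open>d + t'\<close> with \<open>t'\<close> again in \<open>T\<close>; iterating yields its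
  digits. Conversely, prefixing finitely many prescribed digits to a point of \<open>T\<close> stays in \<open>T\<close>, and such
  points converge to the expansion of the whole digit sequence.\<close>

lemma self_affine_unique:
  assumes S: "bounded S" and T: "T \<noteq> {}" "compact T"
    and TS: "(*v) A\<^sub>R ` T = (\<Union>d\<in>S. (\<lambda>t. t + d) ` T)"
  shows "T = expansions S"
proof -
  obtain c where c: "\<And>x. x \<in> S \<Longrightarrow> norm x \<le> c"
    using S by (auto simp: bounded_iff)
  obtain c' where c': "\<And>x. x \<in> T \<Longrightarrow> norm x \<le> c'"
    using compact_imp_bounded[OF T(2)] by (auto simp: bounded_iff)
  have down: "\<exists>t'\<in>T. \<exists>d\<in>S. t = B *v (d + t')" if "t \<in> T" for t
  proof -
    have "A\<^sub>R *v t \<in> (\<Union>d\<in>S. (\<lambda>t. t + d) ` T)" using that TS by blast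
    then obtain d t' where "d \<in> S" "t' \<in> T" "A\<^sub>R *v t = d + t'" by (auto simp: add.commute)
    then show ?thesis by (metis B_A)
  qed
  have up: "B *v (d + t) \<in> T" if "t \<in> T" "d \<in> S" for t d
  proof -
    have "t + d \<in> (*v) A\<^sub>R ` T" using that TS by blast
    then show ?thesis by (auto simp: add.commute)
  qed
  show ?thesis
  proof
    show "T \<subseteq> expansions S"
    proof
      fix t assume t: "t \<in> T"
      obtain t' d where td: "\<And>x. x \<in> T \<Longrightarrow> t' x \<in> T \<and> d x \<in> S \<and> x = B *v (d x + t' x)"
        using down by metis
      define w where "w k = (t' ^^ k) t" for k
      have w: "w k \<in> T" for k by (induction k) (auto simp: w_def t td)
      have step: "w k = B *v (d (w k) + w (Suc k))" for k
        using td[OF w[of k]] by (simp add: w_def)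
      have "w 0 = expansion (\<lambda>k. d (w k))"
        by (rule bounded_backward_orbit[where w = w, OF step]) (auto intro: c c' w td[THEN conjunct2, THEN conjunct1])
      moreover have "(\<lambda>k. d (w k)) \<in> UNIV \<rightarrow> S" using w td by auto
      ultimately show "t \<in> expansions S" by (auto simp: expansions_def w_def)
    qed
  next
    show "expansions S \<subseteq> T"
    proof
      fix t assume "t \<in> expansions S"
      then obtain y where y: "y \<in> UNIV \<rightarrow> S" and t: "t = expansion y"
        by (auto simp: expansions_def)
      obtain t0 where t0: "t0 \<in> T" using T by auto
      let ?b = "c' + K * c / (1 - r)"
      \<comment> \<open>The first \<open>N\<close> digits of \<open>?s N y\<close> are those of \<open>y\<close>; the tail is replaced by \<open>t0\<close>.\<close>
      let ?s = "\<lambda>N y. expansion y + ((*v) B ^^ N) (t0 - expansion (\<lambda>k. y (N + k)))"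
      have s: "?s N y \<in> T" if "y \<in> UNIV \<rightarrow> S" for N y
        using that
      proof (induction N arbitrary: y)
        case (Suc N)
        have "expansion y = B *v (y 0 + expansion (\<lambda>k. y (Suc k)))"
          using Suc.prems c by (intro expansion_unfold[of _ c]) auto
        then have "?s (Suc N) y = B *v (y 0 + ?s N (\<lambda>k. y (Suc k)))"
          by (simp add: matrix_vector_right_distrib)
        moreover have "?s N (\<lambda>k. y (Suc k)) \<in> T" using Suc.prems by (intro Suc.IH) auto
        ultimately show ?case using up Suc.prems by auto
      qed (simp add: t0)
      have "(\<lambda>N. ((*v) B ^^ N) (t0 - expansion (\<lambda>k. y (N + k)))) \<longlonglongrightarrow> 0"
      proof (rule Lim_null_comparison)
        show "\<forall>\<^sub>F N in sequentially. norm (((*v) B ^^ N) (t0 - expansion (\<lambda>k. y (N + k)))) \<le> K * r ^ N * ?b"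
        proof (intro always_eventually allI)
          fix N
          have "norm (t0 - expansion (\<lambda>k. y (N + k))) \<le> ?b"
            using y by (intro order_trans[OF norm_triangle_ineq4] add_mono c' t0 norm_expansion_le c) auto
          then have "K * r ^ N * norm (t0 - expansion (\<lambda>k. y (N + k))) \<le> K * r ^ N * ?b"
            using K_nonneg r by (intro mult_left_mono) auto
          then show "norm (((*v) B ^^ N) (t0 - expansion (\<lambda>k. y (N + k)))) \<le> K * r ^ N * ?b"
            using contracts order_trans by blast
        qed
        show "(\<lambda>N. K * r ^ N * ?b) \<longlonglongrightarrow> 0"
          using r by (auto intro!: tendsto_eq_intros LIMSEQ_power_zero)
      qed
      then have "(\<lambda>N. ?s N y) \<longlonglongrightarrow> expansion y + 0" by (intro tendsto_intros)
      then show "t \<in> T"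
        using closed_sequentially[OF compact_imp_closed[OF T(2)] s[OF y]] t by simp
    qed
  qed
qed

lemma self_affine_set_eq_expansions:
  assumes D: "finite D" "D \<noteq> {}"
  shows "self_affine_set A D = expansions (real_vec ` D)"
proof -
  have bdd: "bounded (real_vec ` D)" and comp: "compact (real_vec ` D)"
    using D by (auto intro: finite_imp_bounded finite_imp_compact)
  show ?thesis
    unfolding self_affine_set_def
  proof (rule the_equality, intro conjI)
    show "expansions (real_vec ` D) \<noteq> {}"
      using D by (auto simp: expansions_def Pi_eq_empty)
    show "compact (expansions (real_vec ` D))" by (rule compact_expansions[OF comp])
    show "(\<lambda>t. A\<^sub>R *v t) ` expansions (real_vec ` D) =
        (\<Union>d\<in>D. (\<lambda>t. t + real_vec d) ` expansions (real_vec ` D))"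
      using expansions_self_affine[OF bdd] by simp
  next
    fix T assume "T \<noteq> {} \<and> compact T \<and> (*v) A\<^sub>R ` T = (\<Union>d\<in>D. (\<lambda>t. t + real_vec d) ` T)"
    then show "T = expansions (real_vec ` D)"
      by (intro self_affine_unique[OF bdd]) auto
  qed
qed

end

section \<open>The nucleus and left-infinite paths\<close>

context wf_digraph
begin

text \<open>The vertices of a left-infinite path are numbered backwards from its end, so walks along it list the
  arcs in descending order.\<close>

lemma left_infinite_path_awalk:
  assumes e: "\<And>k. e k \<in> arcs G" and tl: "\<And>k. tail G (e k) = w (Suc k)"
    and hd: "\<And>k. head G (e k) = w k"
  shows "awalk (w (m + d)) (map e (rev [m..<m + d])) (w m)"
    and "awalk_verts (w (m + d)) (map e (rev [m..<m + d])) = map w (rev [m..<Suc (m + d)])"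
proof (induction d)
  case 0
  have "w m \<in> verts G" by (metis e hd head_in_verts)
  { case 1 then show ?case using \<open>w m \<in> verts G\<close> by (simp add: awalk_Nil_iff) }
  { case 2 then show ?case by simp }
next
  case (Suc d)
  { case 1 then show ?case using Suc e by (simp add: awalk_Cons_iff tl hd) }
  { case 2 then show ?case using Suc by (simp add: tl hd) }
qed

text \<open>If only finitely many vertices occur, some vertex recurs arbitrarily far back, which yields a cycle
  from which every later vertex of the path is reachable.\<close>

lemma left_infinite_path_in_nucleus:
  assumes e: "\<And>k. e k \<in> arcs G" and tl: "\<And>k. tail G (e k) = w (Suc k)"
    and hd: "\<And>k. head G (e k) = w k" and fin: "finite (range w)"
  shows "w j \<in> verts (nucleus G)"
proof -
  have "\<exists>d>0. \<exists>m\<ge>j. w m = w (m + d)"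
  proof -
    have "finite (w ` {j..})" by (rule finite_subset[OF _ fin]) auto
    then have "\<not> inj_on w {j..}"
      using finite_imageD infinite_Ici by blast
    then obtain a b where ab: "j \<le> a" "j \<le> b" "a \<noteq> b" "w a = w b" by (auto simp: inj_on_def)
    have "w (min a b) = w (min a b + (max a b - min a b))"
      using ab by (auto simp: min_def max_def)
    then show ?thesis
      using ab by (intro exI[of _ "max a b - min a b"]) (auto intro!: exI[of _ "min a b"])
  qed
  \<comment> \<open>A closest repetition closes up a walk without inner repetitions, that is, a cycle.\<close>
  then obtain d where d: "d > 0" "\<exists>m\<ge>j. w m = w (m + d)"
    and least: "\<And>d'. d' > 0 \<Longrightarrow> \<exists>m\<ge>j. w m = w (m + d') \<Longrightarrow> d \<le> d'"
    using exists_least_iff[of "\<lambda>d. d > 0 \<and> (\<exists>m\<ge>j. w m = w (m + d))"] by (meson not_less)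
  from d obtain m where m: "m \<ge> j" "w m = w (m + d)" by blast
  let ?p = "map e (rev [m..<m + d])"
  have "inj_on w {m..<m + d}"
  proof (rule linorder_inj_onI)
    fix x y assume xy: "x < y" "x \<in> {m..<m + d}" "y \<in> {m..<m + d}"
    show "w x \<noteq> w y"
    proof
      assume "w x = w y"
      then have "d \<le> y - x"
        using xy m by (intro least exI[of _ x]) auto
      with xy show False by auto
    qed
  qed auto
  then have dist: "distinct (map w (rev [m..<m + d]))"
    by (simp add: distinct_map)
  note walk = left_infinite_path_awalk[of e w, OF e tl hd]
  have "cycle ?p"
    unfolding cycle_def
  proof (intro exI conjI)
    show "awalk (w (m + d)) ?p (w (m + d))" using walk(1)[of m d] m by simp
    show "distinct (tl (awalk_verts (w (m + d)) ?p))" using dist by (simp add: walk(2))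
    show "?p \<noteq> []" using d by simp
  qed
  moreover have "e (m + d - 1) \<in> set ?p" using d by auto
  moreover have "reachable G (tail G (e (m + d - 1))) (w j)"
  proof -
    have "tail G (e (m + d - 1)) = w m" using d m by (simp add: tl)
    moreover have "awalk (w (j + (m - j))) (map e (rev [j..<j + (m - j)])) (w j)" by (rule walk(1))
    ultimately show ?thesis using m by (auto simp: reachable_awalk)
  qed
  ultimately show ?thesis unfolding nucleus_def induce_subgraph_verts by blast
qed

lemma awalk_vertex_predecessor:
  assumes "awalk u p v" "x \<in> set (awalk_verts u p)"
  shows "x = u \<or> (\<exists>e\<in>set p. head G e = x \<and> tail G e \<in> set (awalk_verts u p))"
  using assms
proof (induction p arbitrary: u)
  case (Cons e p)
  then show ?case by (cases p) (auto simp: awalk_Cons_iff)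
qed simp

text \<open>The vertices of the cycle together with those of a walk from it to \<open>v\<close> form a finite set in which
  every vertex has a predecessor, so the path can be continued backwards forever inside it.\<close>

lemma nucleus_left_infinite_path:
  assumes "v \<in> verts (nucleus G)"
  obtains w e where "w 0 = v" "\<And>k. e k \<in> arcs G" "\<And>k. tail G (e k) = w (Suc k)"
    "\<And>k. head G (e k) = w k" "finite (range w)"
proof -
  obtain p a where "cycle p" and a: "a \<in> set p" "reachable G (tail G a) v"
    using assms by (auto simp: nucleus_def)
  then obtain u where p: "awalk u p u" "p \<noteq> []" by (auto simp: cycle_def)
  obtain q where q: "awalk (tail G a) q v" using a by (auto simp: reachable_awalk)
  let ?P = "set (awalk_verts u p)" and ?Q = "set (awalk_verts (tail G a) q)"
  let ?S = "?P \<union> ?Q"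
  have pP: "tail G x \<in> ?P" if "x \<in> set p" for x
    using that p by (auto simp: awalk_verts_conv)
  have pred: "\<exists>b\<in>arcs G. head G b = x \<and> tail G b \<in> ?S" if "x \<in> ?S" for x
  proof -
    have P: "\<exists>b\<in>set p. head G b = x \<and> tail G b \<in> ?P" if "x \<in> ?P" for x
    proof (cases "x = u")
      case True
      then have "head G (last p) = x" using p by (auto simp: awalk_def awalk_verts_conv dest: awlast_if_cas)
      then show ?thesis using p pP[of "last p"] by auto
    next
      case False
      then show ?thesis using awalk_vertex_predecessor[OF p(1) that] by auto
    qed
    have "x \<in> ?P \<or> (\<exists>b\<in>set q. head G b = x \<and> tail G b \<in> ?Q)"
      using that awalk_vertex_predecessor[OF q, of x] pP[OF a(1)] by auto
    moreover have "set p \<subseteq> arcs G" "set q \<subseteq> arcs G" using p q by (auto simp: awalk_def)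
    ultimately show ?thesis using P[of x] by blast
  qed
  then obtain b where b: "\<And>x. x \<in> ?S \<Longrightarrow> b x \<in> arcs G \<and> head G (b x) = x \<and> tail G (b x) \<in> ?S"
    by metis
  define w where "w k = ((\<lambda>x. tail G (b x)) ^^ k) v" for k
  have v: "v \<in> ?S" using awlast_in_verts q by (metis UnCI awalk_verts_non_Nil last_in_set awalkE)
  have w: "w k \<in> ?S" for k
    by (induction k) (use v b in \<open>auto simp: w_def\<close>)
  show ?thesis
  proof (rule that[of w "\<lambda>k. b (w k)"])
    show "finite (range w)" by (rule finite_subset[of _ ?S]) (use w in auto)
  qed (use w b in \<open>auto simp: w_def\<close>)
qed

end

lemma wf_Gamma_graph: "wf_digraph (Gamma_graph A E)"
  by unfold_locales (auto simp: Gamma_graph_def labeled_digraph_def)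

lemma arcs_Gamma_graph:
  "(u, (x, y), v) \<in> arcs (Gamma_graph A E) \<longleftrightarrow> x \<in> E \<and> y \<in> E \<and> u + x = y + A *v v"
  by (simp add: Gamma_graph_def labeled_digraph_def)

lemma tail_Gamma_graph: "tail (Gamma_graph A E) (u, l, v) = u"
  and head_Gamma_graph: "head (Gamma_graph A E) (u, l, v) = v"
  by (simp_all add: Gamma_graph_def labeled_digraph_def)

lemma finite_bounded_int_vecs:
  "finite {v :: int ^ 'n. norm (real_vec v) \<le> b}"
proof -
  let ?f = "\<lambda>v :: int ^ 'n. ($) v"
  have "v $ i \<in> {- \<lceil>b\<rceil>..\<lceil>b\<rceil>}" if "norm (real_vec v) \<le> b" for v :: "int ^ 'n" and i
  proof -
    have "\<bar>real_of_int (v $ i)\<bar> \<le> b"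
      using component_le_norm_cart[of "real_vec v" i] that by (simp add: real_vec_def)
    then show ?thesis by (simp add: abs_le_iff) linarith
  qed
  then have "?f ` {v. norm (real_vec v) \<le> b} \<subseteq> PiE UNIV (\<lambda>_. {- \<lceil>b\<rceil>..\<lceil>b\<rceil>})"
    by auto
  moreover have "finite (PiE (UNIV :: 'n set) (\<lambda>_. {- \<lceil>b\<rceil>..\<lceil>b\<rceil>}))"
    by (intro finite_PiE) auto
  ultimately have "finite (?f ` {v. norm (real_vec v) \<le> b})"
    by (rule finite_subset)
  then show ?thesis by (rule finite_imageD) (auto simp: inj_on_def vec_nth_inject)
qed

context contracting_inverse
begin

text \<open>Following an edge forward is one contracting step with digit \<open>x - y\<close>. This is why infinite paths in
  the graph compute differences of expansions.\<close>

lemma edge_iff_backward_step: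
  "u + x = y + A *v v \<longleftrightarrow> real_vec v = B *v ((real_vec x - real_vec y) + real_vec u)"
proof -
  have "u + x = y + A *v v \<longleftrightarrow> real_vec (u + x) = real_vec (y + A *v v)"
    using inj_real_vec by (auto simp: inj_def)
  also have "\<dots> \<longleftrightarrow> A\<^sub>R *v real_vec v = real_vec x - real_vec y + real_vec u"
    by (auto simp: real_vec_add real_vec_matrix_mult algebra_simps)
  also have "\<dots> \<longleftrightarrow> real_vec v = B *v ((real_vec x - real_vec y) + real_vec u)"
    by (metis A_B B_A)
  finally show ?thesis .
qed

lemma path_end_vertex:
  assumes E: "finite E" and w: "finite (range w)"
    and arcs: "\<And>k. (w (Suc k), (x k, y k), w k) \<in> arcs (Gamma_graph A E)"
  shows "real_vec (w 0) = value_of x - value_of y"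
proof -
  obtain c where c: "\<And>a. a \<in> E \<Longrightarrow> norm (real_vec a) \<le> c"
    using finite_imp_bounded[OF finite_imageI[OF E, of real_vec]] by (auto simp: bounded_iff)
  obtain c' where c': "\<And>k. norm (real_vec (w k)) \<le> c'"
    using finite_imp_bounded[OF finite_imageI[OF w, of real_vec]] by (auto simp: bounded_iff)
  have xy: "norm (real_vec (x k)) \<le> c" "norm (real_vec (y k)) \<le> c" for k
    using arcs[of k] c by (auto simp: arcs_Gamma_graph)
  have step: "real_vec (w k) = B *v ((real_vec (x k) - real_vec (y k)) + real_vec (w (Suc k)))" for k
    using arcs[of k] by (simp only: arcs_Gamma_graph edge_iff_backward_step)
  have "norm (real_vec (x k) - real_vec (y k)) \<le> c + c" for k
    by (rule order_trans[OF norm_triangle_ineq4 add_mono[OF xy]])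
  then have "real_vec (w 0) = expansion (\<lambda>k. real_vec (x k) - real_vec (y k))"
    by (rule bounded_backward_orbit[where w = "\<lambda>k. real_vec (w k)", OF step _ c'])
  also have "\<dots> = value_of x - value_of y"
    by (rule expansion_diff[OF xy])
  finally show ?thesis .
qed

text \<open>The norms of nucleus vertices are bounded, because each of them is the difference of two expansions
  with digits in \<open>E\<close>.\<close>

lemma finite_nucleus:
  assumes "finite E"
  shows "finite (verts (nucleus (Gamma_graph A E)))"
proof -
  obtain c where c: "\<And>a. a \<in> E \<Longrightarrow> norm (real_vec a) \<le> c"
    using finite_imp_bounded[OF finite_imageI[OF assms, of real_vec]] by (auto simp: bounded_iff)
  let ?b = "K * c / (1 - r)"
  have "norm (real_vec v) \<le> ?b + ?b" if v: "v \<in> verts (nucleus (Gamma_graph A E))" for v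
  proof -
    obtain w e where w: "w 0 = v" "\<And>k. e k \<in> arcs (Gamma_graph A E)"
      "\<And>k. tail (Gamma_graph A E) (e k) = w (Suc k)" "\<And>k. head (Gamma_graph A E) (e k) = w k"
      "finite (range w)"
      using wf_digraph.nucleus_left_infinite_path[OF wf_Gamma_graph v] by metis
    define x y where "x k = fst (fst (snd (e k)))" and "y k = snd (fst (snd (e k)))" for k
    have e: "e k = (w (Suc k), (x k, y k), w k)" for k
      using w(3)[of k] w(4)[of k]
      by (cases "e k") (auto simp: tail_Gamma_graph head_Gamma_graph x_def y_def)
    have arcs: "(w (Suc k), (x k, y k), w k) \<in> arcs (Gamma_graph A E)" for k
      using w(2)[of k] by (simp add: e)
    have "real_vec v = value_of x - value_of y"
      using path_end_vertex[OF assms w(5) arcs] w(1) by simp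
    moreover have "norm (value_of x) \<le> ?b" "norm (value_of y) \<le> ?b"
      using arcs by (auto intro!: norm_expansion_le c simp: arcs_Gamma_graph)
    ultimately show ?thesis
      using norm_triangle_ineq4[of "value_of x" "value_of y"] by simp
  qed
  then show ?thesis
    by (intro finite_subset[OF _ finite_bounded_int_vecs[of "?b + ?b"]]) auto
qed

text \<open>The edge relation forces the path: with \<open>v\<close> as last vertex, all earlier vertices are determined and
  integral. Each of them is a difference of expansions of shifted digit sequences, which makes the set of
  vertices bounded and therefore finite.\<close>

lemma path_of_expansions:
  assumes E: "finite E" and x: "\<And>k. x k \<in> E" and y: "\<And>k. y k \<in> E"
    and v: "real_vec v = value_of x - value_of y"
  obtains w where "w 0 = v" "finite (range w)"
    "\<And>k. (w (Suc k), (x k, y k), w k) \<in> arcs (Gamma_graph A E)"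
proof -
  obtain c where c: "\<And>a. a \<in> E \<Longrightarrow> norm (real_vec a) \<le> c"
    using finite_imp_bounded[OF finite_imageI[OF E, of real_vec]] by (auto simp: bounded_iff)
  define w where "w = rec_nat v (\<lambda>k u. y k - x k + A *v u)"
  have w: "w 0 = v" "w (Suc k) = y k - x k + A *v w k" for k by (simp_all add: w_def)
  have eq: "real_vec (w k) = value_of (\<lambda>j. x (k + j)) - value_of (\<lambda>j. y (k + j))" for k
  proof (induction k)
    case (Suc k)
    have unfold: "value_of (\<lambda>j. z (k + j)) = B *v (real_vec (z k) + value_of (\<lambda>j. z (Suc (k + j))))"
      if "\<And>k. z k \<in> E" for z
      using expansion_unfold[of "\<lambda>j. real_vec (z (k + j))" c] that c by simp
    have "real_vec (w k) = B *v (real_vec (x k) + value_of (\<lambda>j. x (Suc (k + j))))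
        - B *v (real_vec (y k) + value_of (\<lambda>j. y (Suc (k + j))))"
      using Suc unfold[of x, OF x] unfold[of y, OF y] by simp
    then show ?case
      by (simp add: w real_vec_add real_vec_diff real_vec_matrix_mult matrix_vector_mult_diff_distrib)
  qed (simp add: w v)
  let ?b = "K * c / (1 - r)"
  have "norm (real_vec (w k)) \<le> ?b + ?b" for k
    unfolding eq
    by (intro order_trans[OF norm_triangle_ineq4] add_mono norm_expansion_le c x y)
  then have "finite (range w)"
    by (intro finite_subset[OF _ finite_bounded_int_vecs[of "?b + ?b"]]) auto
  then show ?thesis
    by (intro that[of w]) (auto simp: w arcs_Gamma_graph x y)
qed

text \<open>The link between graph and geometry: reading \<open>x\<close> into the vertex \<open>v\<close> means that the point with
  digits \<open>x\<close> lies in \<open>T + v\<close>.\<close>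

lemma left_infinite_labels_nucleus:
  assumes E: "finite E" "C \<subseteq> E" "D \<subseteq> E"
  shows "x \<in> left_infinite_labels (restrict_labels (nucleus (Gamma_graph A E)) C D) v \<longleftrightarrow>
    (\<forall>k. x k \<in> C) \<and> value_of x - real_vec v \<in> expansions (real_vec ` D)"
proof
  let ?N = "nucleus (Gamma_graph A E)"
  assume "x \<in> left_infinite_labels (restrict_labels ?N C D) v"
  then obtain w where w0: "w 0 = v"
    and "\<And>k. (w (Suc k), x k, w k) \<in> arcs (restrict_labels ?N C D)"
    by (auto simp: left_infinite_labels_def)
  then have "\<forall>k. x k \<in> C \<and> (\<exists>b\<in>D. (w (Suc k), (x k, b), w k) \<in> arcs ?N)"
    by (auto simp: restrict_labels_def labeled_digraph_def)
  then obtain y where x: "\<And>k. x k \<in> C" and y: "\<And>k. y k \<in> D"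
    and N: "\<And>k. (w (Suc k), (x k, y k), w k) \<in> arcs ?N"
    by metis
  have arcs: "(w (Suc k), (x k, y k), w k) \<in> arcs (Gamma_graph A E)" and vert: "w k \<in> verts ?N" for k
    using N[of k] by (auto simp: nucleus_def induce_subgraph_def head_Gamma_graph)
  have "finite (range w)"
    by (rule finite_subset[OF _ finite_nucleus[OF E(1)]]) (use vert in auto)
  then have "value_of x - real_vec v = value_of y"
    using path_end_vertex[where w = w and x = x and y = y, OF E(1) _ arcs] w0 by simp
  then show "(\<forall>k. x k \<in> C) \<and> value_of x - real_vec v \<in> expansions (real_vec ` D)"
    using x y by (auto simp: expansions_def)
next
  let ?N = "nucleus (Gamma_graph A E)"
  assume *: "(\<forall>k. x k \<in> C) \<and> value_of x - real_vec v \<in> expansions (real_vec ` D)"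
  then obtain z where "z \<in> UNIV \<rightarrow> real_vec ` D" and z: "value_of x - real_vec v = expansion z"
    by (auto simp: expansions_def)
  then have "\<forall>k. z k \<in> real_vec ` D" by auto
  then obtain y where y: "\<And>k. y k \<in> D" "\<And>k. z k = real_vec (y k)"
    unfolding image_iff by metis
  then have "z = (\<lambda>k. real_vec (y k))" by auto
  with z have v: "real_vec v = value_of x - value_of y" by (simp add: algebra_simps)
  obtain w where w: "w 0 = v" "finite (range w)"
    "\<And>k. (w (Suc k), (x k, y k), w k) \<in> arcs (Gamma_graph A E)"
    using path_of_expansions[OF E(1) _ _ v] * y E by blast
  have "w j \<in> verts ?N" for j
    using wf_digraph.left_infinite_path_in_nucleus[OF wf_Gamma_graph w(3) _ _ w(2)]
    by (simp add: tail_Gamma_graph head_Gamma_graph)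
  with w(3) have "(w (Suc k), (x k, y k), w k) \<in> arcs ?N" for k
    by (auto simp: nucleus_def induce_subgraph_def head_Gamma_graph tail_Gamma_graph)
  with * y w(1) show "x \<in> left_infinite_labels (restrict_labels ?N C D) v"
    by (auto simp: left_infinite_labels_def restrict_labels_def labeled_digraph_def
        intro!: exI[of _ w])
qed

end

section \<open>Lebesgue measure as the sum of the integer translates of the digit distribution\<close>

locale digit_system = contracting_inverse A B K r
  for A :: "int ^ 'n ^ 'n" and B K r +
  fixes C :: "(int ^ 'n) set"
  assumes finite_C: "finite C" and transversal: "coset_transversal A C"
begin

abbreviation \<mu> :: "(nat \<Rightarrow> int ^ 'n) measure" where "\<mu> \<equiv> bernoulli_measure C"

lemma C_nonempty: "C \<noteq> {}"
  using transversal by (auto simp: coset_transversal_def)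

text \<open>Division with remainder by \<open>A\<close> in \<open>\<int>\<^sup>n\<close>, with the remainders negated.\<close>

lemma bij_quotient_remainder: "bij_betw (\<lambda>(v, c). A *v v - c) (UNIV \<times> C) UNIV"
proof (rule bij_betwI')
  have inj_A: "v = v'" if "A *v v = A *v v'" for v v'
  proof -
    have "A\<^sub>R *v real_vec v = A\<^sub>R *v real_vec v'" using that by (metis real_vec_matrix_mult)
    then have "real_vec v = real_vec v'" by (metis B_A)
    then show ?thesis by (rule injD[OF inj_real_vec])
  qed
  fix p q :: "(int ^ 'n) \<times> (int ^ 'n)" assume "p \<in> UNIV \<times> C" "q \<in> UNIV \<times> C"
  then obtain v c v' c' where pq: "p = (v, c)" "q = (v', c')" "c \<in> C" "c' \<in> C" by auto
  show "((\<lambda>(v, c). A *v v - c) p = (\<lambda>(v, c). A *v v - c) q) = (p = q)"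
  proof
    assume "(\<lambda>(v, c). A *v v - c) p = (\<lambda>(v, c). A *v v - c) q"
    then have eq: "A *v v - c = A *v v' - c'" using pq by simp
    then have "c' = c + A *v (v' - v)" "c = c + A *v 0"
      by (auto simp: matrix_vector_mult_diff_distrib algebra_simps)
    then have "c = c'" using transversal pq unfolding coset_transversal_def by blast
    with eq inj_A show "p = q" by (simp add: pq)
  qed simp
next
  fix u :: "int ^ 'n"
  obtain c where "c \<in> C" "c \<in> range (\<lambda>z. - u + A *v z)"
    using transversal unfolding coset_transversal_def by blast
  then obtain z where "c \<in> C" "c = - u + A *v z" by blast
  then show "\<exists>x\<in>UNIV \<times> C. u = (\<lambda>(v, c). A *v v - c) x"
    by (intro bexI[of _ "(z, c)"]) auto
qed auto

sublocale digit: prob_space "uniform_count_measure C"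
  using finite_C C_nonempty by (rule prob_space_uniform_count_measure)

sublocale digits: sequence_space "uniform_count_measure C" ..

sublocale digits_space: prob_space \<mu>
  unfolding bernoulli_measure_def by (rule prob_space_PiM) (rule digit.prob_space_axioms)

sublocale fubini: pair_sigma_finite lborel \<mu> ..

lemma space_digits: "x \<in> space \<mu> \<longleftrightarrow> (\<forall>k. x k \<in> C)"
  by (auto simp: bernoulli_measure_def space_PiM space_uniform_count_measure PiE_UNIV_domain)

lemma measurable_value_of [measurable]: "value_of \<in> borel_measurable \<mu>"
proof -
  have "(\<lambda>x. real_vec (x k)) \<in> borel_measurable \<mu>" for k
    unfolding bernoulli_measure_def
    by (rule measurable_compose[OF measurable_component_singleton])
      (auto simp: uniform_count_measure_def)
  moreover have "((*v) B ^^ Suc k) \<in> borel_measurable borel" for k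
    by (intro borel_measurable_continuous_onI linear_continuous_on
        linear_matrix_funpow[unfolded linear_conv_bounded_linear])
  ultimately have "(\<lambda>x. ((*v) B ^^ Suc k) (real_vec (x k))) \<in> borel_measurable \<mu>" for k
    by (rule measurable_compose)
  then show ?thesis unfolding expansion_def by (rule borel_measurable_suminf)
qed

text \<open>The first digit is uniform on \<open>C\<close> and independent of the others, which are distributed like the
  whole sequence.\<close>

lemma nn_integral_value_of_split:
  assumes [measurable]: "g \<in> borel_measurable borel"
  shows "(\<integral>\<^sup>+x. g (value_of x) \<partial>\<mu>)
    = ennreal (1 / card C) * (\<Sum>c\<in>C. \<integral>\<^sup>+x. g (B *v (real_vec c + value_of x)) \<partial>\<mu>)"
proof -
  let ?M = "uniform_count_measure C"
  let ?f = "\<lambda>(c, x). case_nat c x :: nat \<Rightarrow> int ^ 'n"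
  obtain b where b: "\<And>c. c \<in> C \<Longrightarrow> norm (real_vec c) \<le> b"
    using finite_imp_bounded[OF finite_imageI[OF finite_C, of real_vec]] by (auto simp: bounded_iff)
  have f: "?f \<in> measurable (?M \<Otimes>\<^sub>M \<mu>) \<mu>"
    unfolding bernoulli_measure_def by measurable
  have "\<mu> = distr (?M \<Otimes>\<^sub>M \<mu>) \<mu> ?f"
    unfolding bernoulli_measure_def by (rule digits.PiM_iter[symmetric])
  then have "(\<integral>\<^sup>+x. g (value_of x) \<partial>\<mu>) = (\<integral>\<^sup>+x. g (value_of x) \<partial>distr (?M \<Otimes>\<^sub>M \<mu>) \<mu> ?f)"
    by simp
  also have "\<dots> = (\<integral>\<^sup>+p. g (value_of (?f p)) \<partial>(?M \<Otimes>\<^sub>M \<mu>))"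
    by (rule nn_integral_distr[OF f]) measurable
  also have "\<dots> = (\<integral>\<^sup>+c. \<integral>\<^sup>+x. g (value_of (?f (c, x))) \<partial>\<mu> \<partial>?M)"
    by (rule digits_space.nn_integral_fst[symmetric])
      (rule measurable_compose[OF f], measurable)
  also have "\<dots> = (\<integral>\<^sup>+c. \<integral>\<^sup>+x. g (B *v (real_vec c + value_of x)) \<partial>\<mu> \<partial>?M)"
  proof (intro nn_integral_cong)
    fix c x assume "c \<in> space ?M" "x \<in> space \<mu>"
    then have "\<And>k. case_nat c x k \<in> C"
      by (auto simp: space_digits space_uniform_count_measure split: nat.split)
    then have "value_of (case_nat c x) = B *v (real_vec c + value_of x)"
      by (subst expansion_unfold[of _ b]) (auto intro: b)
    then show "g (value_of (?f (c, x))) = g (B *v (real_vec c + value_of x))" by simp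
  qed
  finally show ?thesis
    unfolding uniform_count_measure_def
    by (simp add: nn_integral_point_measure_finite finite_C sum_distrib_left)
qed

text \<open>The sum over all integer vectors \<open>v\<close> of the distribution of \<open>value_of x - v\<close>, where the digits \<open>x\<close> are
  drawn from the Bernoulli measure. Realizing the sum as an image of a product with the counting
  measure makes it a measure by construction.\<close>

definition translates_measure :: "(real ^ 'n) measure" where
  "translates_measure =
     distr (count_space UNIV \<Otimes>\<^sub>M \<mu>) borel (\<lambda>(v, x). value_of x - real_vec v)"

lemma sets_translates_measure [simp, measurable_cong]: "sets translates_measure = sets borel"
  by (simp add: translates_measure_def)

lemma nn_integral_translates_measure:
  assumes [measurable]: "f \<in> borel_measurable borel"
  shows "(\<integral>\<^sup>+t. f t \<partial>translates_measure)
    = (\<integral>\<^sup>+v. \<integral>\<^sup>+x. f (value_of x - real_vec v) \<partial>\<mu> \<partial>count_space UNIV)"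
proof -
  have [measurable]: "(\<lambda>p. value_of (snd p) - real_vec (fst p)) \<in> borel_measurable (count_space UNIV \<Otimes>\<^sub>M \<mu>)"
    by measurable
  have "(\<integral>\<^sup>+t. f t \<partial>translates_measure)
      = (\<integral>\<^sup>+p. f (value_of (snd p) - real_vec (fst p)) \<partial>(count_space UNIV \<Otimes>\<^sub>M \<mu>))"
    unfolding translates_measure_def by (subst nn_integral_distr) (auto simp: case_prod_unfold)
  also have "\<dots> = (\<integral>\<^sup>+v. \<integral>\<^sup>+x. f (value_of x - real_vec v) \<partial>\<mu> \<partial>count_space UNIV)"
    by (subst digits_space.nn_integral_fst[symmetric]) auto
  finally show ?thesis .
qed

lemma translates_measure_int_shift:
  assumes [measurable]: "f \<in> borel_measurable borel"
  shows "(\<integral>\<^sup>+t. f (t + real_vec u) \<partial>translates_measure) = (\<integral>\<^sup>+t. f t \<partial>translates_measure)"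
proof -
  have "bij_betw (\<lambda>v. v - u) UNIV UNIV"
    by (rule bij_betw_byWitness[where f' = "\<lambda>v. v + u"]) auto
  from nn_integral_bij_count_space[OF this,
      of "\<lambda>v. \<integral>\<^sup>+x. f (value_of x - real_vec v) \<partial>\<mu>"]
  show ?thesis
    by (simp add: nn_integral_translates_measure real_vec_diff algebra_simps)
qed

text \<open>Multiplying by \<open>A\<close> moves the first digit \<open>c\<close> to the left of the radix point, and the translation
  vector becomes \<open>A v - c\<close>. By division with remainder these vectors run through all of \<open>\<int>\<^sup>n\<close> exactly
  once, so the sum over all translates reproduces itself up to the factor \<open>1 / card C\<close>.\<close>

lemma translates_measure_self_similar:
  assumes [measurable]: "f \<in> borel_measurable borel"
  shows "(\<integral>\<^sup>+t. f (A\<^sub>R *v t) \<partial>translates_measure)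
    = ennreal (1 / card C) * (\<integral>\<^sup>+t. f t \<partial>translates_measure)"
proof -
  have [measurable]: "(*v) A\<^sub>R \<in> borel_measurable borel"
    by (intro borel_measurable_continuous_onI linear_continuous_on) simp
  have "(\<integral>\<^sup>+x. f (A\<^sub>R *v (value_of x - real_vec v)) \<partial>\<mu>)
      = ennreal (1 / card C) * (\<integral>\<^sup>+c. \<integral>\<^sup>+x. f (value_of x - real_vec (A *v v - c)) \<partial>\<mu> \<partial>count_space C)" for v
    by (subst nn_integral_value_of_split[where g = "\<lambda>t. f (A\<^sub>R *v (t - real_vec v))"])
      (auto simp: nn_integral_count_space_finite finite_C real_vec_diff real_vec_matrix_mult
        matrix_vector_mult_diff_distrib algebra_simps)
  then have "(\<integral>\<^sup>+t. f (A\<^sub>R *v t) \<partial>translates_measure)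
      = (\<integral>\<^sup>+v. ennreal (1 / card C) * (\<integral>\<^sup>+c. \<integral>\<^sup>+x. f (value_of x - real_vec (A *v v - c))
          \<partial>\<mu> \<partial>count_space C) \<partial>count_space UNIV)"
    by (simp add: nn_integral_translates_measure)
  also have "\<dots> = ennreal (1 / card C) * (\<integral>\<^sup>+v. \<integral>\<^sup>+c. \<integral>\<^sup>+x. f (value_of x - real_vec (A *v v - c))
          \<partial>\<mu> \<partial>count_space C \<partial>count_space UNIV)"
    by (rule nn_integral_cmult) simp
  also have "(\<integral>\<^sup>+v. \<integral>\<^sup>+c. \<integral>\<^sup>+x. f (value_of x - real_vec (A *v v - c)) \<partial>\<mu> \<partial>count_space C \<partial>count_space UNIV)
      = (\<integral>\<^sup>+p. (case p of (v, c) \<Rightarrow> \<integral>\<^sup>+x. f (value_of x - real_vec (A *v v - c)) \<partial>\<mu>)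
          \<partial>count_space (UNIV \<times> C))"
  proof -
    interpret C: sigma_finite_measure "count_space C"
      by (rule sigma_finite_measure_count_space_finite[OF finite_C])
    have prod: "count_space (UNIV :: (int ^ 'n) set) \<Otimes>\<^sub>M count_space C = count_space (UNIV \<times> C)"
      by (rule pair_measure_countable) (auto intro: countable_finite finite_C)
    let ?F = "\<lambda>(v, c). \<integral>\<^sup>+x. f (value_of x - real_vec (A *v v - c)) \<partial>\<mu>"
    have "(\<integral>\<^sup>+v. \<integral>\<^sup>+c. ?F (v, c) \<partial>count_space C \<partial>count_space UNIV)
        = (\<integral>\<^sup>+p. ?F p \<partial>(count_space UNIV \<Otimes>\<^sub>M count_space C))"
      by (rule C.nn_integral_fst) (simp add: prod)
    then show ?thesis by (simp add: prod)
  qed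
  also have "\<dots> = (\<integral>\<^sup>+u. \<integral>\<^sup>+x. f (value_of x - real_vec u) \<partial>\<mu> \<partial>count_space UNIV)"
    using nn_integral_bij_count_space[OF bij_quotient_remainder, of "\<lambda>u. \<integral>\<^sup>+x. f (value_of x - real_vec u) \<partial>\<mu>"]
    by (simp add: case_prod_unfold)
  finally show ?thesis by (simp add: nn_integral_translates_measure)
qed

text \<open>Conjugating a translation by \<open>A\<close> refines it: self-similarity transports invariance under \<open>s\<close> to
  invariance under \<open>A\<^sup>-\<^sup>1 s\<close>. The factor \<open>1 / card C\<close> that \<open>A\<close> produces is taken back by the return to \<open>f\<close>.\<close>

lemma translates_measure_shift_contract:
  assumes s: "\<And>f. f \<in> borel_measurable borel \<Longrightarrow>
      (\<integral>\<^sup>+t. f (t + s) \<partial>translates_measure) = (\<integral>\<^sup>+t. f t \<partial>translates_measure)"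
    and f [measurable]: "f \<in> borel_measurable borel"
  shows "(\<integral>\<^sup>+t. f (t + B *v s) \<partial>translates_measure) = (\<integral>\<^sup>+t. f t \<partial>translates_measure)"
proof -
  let ?k = "ennreal (1 / card C)"
  have [measurable]: "(*v) B \<in> borel_measurable borel"
    by (intro borel_measurable_continuous_onI linear_continuous_on) simp
  define h where "h t = f (B *v t)" for t
  have h [measurable]: "h \<in> borel_measurable borel" unfolding h_def by measurable
  have "(\<integral>\<^sup>+t. f (t + B *v s) \<partial>translates_measure) = (\<integral>\<^sup>+t. h (A\<^sub>R *v t + s) \<partial>translates_measure)"
    by (simp add: h_def matrix_vector_right_distrib)
  also have "\<dots> = ?k * (\<integral>\<^sup>+t. h (t + s) \<partial>translates_measure)"
    by (rule translates_measure_self_similar[where f = "\<lambda>t. h (t + s)"]) measurable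
  also have "(\<integral>\<^sup>+t. h (t + s) \<partial>translates_measure) = (\<integral>\<^sup>+t. h t \<partial>translates_measure)"
    by (rule s[OF h])
  also have "?k * \<dots> = (\<integral>\<^sup>+t. h (A\<^sub>R *v t) \<partial>translates_measure)"
    by (rule translates_measure_self_similar[OF h, symmetric])
  finally show ?thesis by (simp add: h_def)
qed

lemma translates_measure_fine_shift:
  assumes "f \<in> borel_measurable borel"
  shows "(\<integral>\<^sup>+t. f (t + ((*v) B ^^ k) (real_vec u)) \<partial>translates_measure) = (\<integral>\<^sup>+t. f t \<partial>translates_measure)"
  using assms
proof (induction k arbitrary: f)
  case 0
  then show ?case by (simp add: translates_measure_int_shift)
next
  case (Suc k)
  show ?case
    using translates_measure_shift_contract[OF Suc.IH Suc.prems] by simp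
qed

text \<open>Rounding \<open>A\<^sup>k s\<close> to an integer vector commits a bounded error, which \<open>A\<^sup>-\<^sup>k\<close> shrinks to zero.\<close>

lemma fine_grid_dense:
  obtains g :: "nat \<Rightarrow> int ^ 'n" where "(\<lambda>k. ((*v) B ^^ k) (real_vec (g k))) \<longlonglongrightarrow> s"
proof
  let ?a = "\<lambda>k. ((*v) A\<^sub>R ^^ k) s"
  let ?g = "\<lambda>k. (\<chi> i. \<lfloor>?a k $ i\<rfloor>) :: int ^ 'n"
  have inv: "((*v) B ^^ k) (((*v) A\<^sub>R ^^ k) x) = x" for k x
    by (induction k arbitrary: x) (auto simp: funpow_swap1)
  have "(\<lambda>k. ((*v) B ^^ k) (real_vec (?g k)) - s) \<longlonglongrightarrow> 0"
  proof (rule Lim_null_comparison)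
    show "\<forall>\<^sub>F k in sequentially. norm (((*v) B ^^ k) (real_vec (?g k)) - s) \<le> K * r ^ k * CARD('n)"
    proof (intro always_eventually allI)
      fix k
      have "((*v) B ^^ k) (real_vec (?g k)) - s = ((*v) B ^^ k) (real_vec (?g k) - ?a k)"
        using inv[of k s] by (simp add: linear_diff[OF linear_matrix_funpow])
      then have "norm (((*v) B ^^ k) (real_vec (?g k)) - s) \<le> K * r ^ k * norm (real_vec (?g k) - ?a k)"
        using contracts by simp
      also have "norm (real_vec (?g k) - ?a k) \<le> (\<Sum>i\<in>UNIV. \<bar>(real_vec (?g k) - ?a k) $ i\<bar>)"
        by (rule norm_le_l1_cart)
      also have "\<dots> \<le> (\<Sum>i\<in>(UNIV :: 'n set). 1)"
        by (intro sum_mono) (simp add: real_vec_def, linarith)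
      finally show "norm (((*v) B ^^ k) (real_vec (?g k)) - s) \<le> K * r ^ k * CARD('n)"
        using K_nonneg r by (simp add: mult_left_mono)
    qed
    show "(\<lambda>k. K * r ^ k * CARD('n)) \<longlonglongrightarrow> 0"
      using r by (auto intro!: tendsto_eq_intros LIMSEQ_power_zero)
  qed
  then show "(\<lambda>k. ((*v) B ^^ k) (real_vec (?g k))) \<longlonglongrightarrow> s"
    by (simp add: LIM_zero_iff)
qed

text \<open>The indicator of an open set is lower semicontinuous, so Fatou's lemma extends invariance from the
  dense set of fine grid vectors to an inequality for all translations.\<close>

lemma translates_measure_open_shift_le:
  assumes "open U"
  shows "(\<integral>\<^sup>+t. indicator U (t + s) \<partial>translates_measure) \<le> (\<integral>\<^sup>+t. indicator U t \<partial>translates_measure)"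
proof -
  obtain g where g: "(\<lambda>k. ((*v) B ^^ k) (real_vec (g k))) \<longlonglongrightarrow> s"
    by (rule fine_grid_dense)
  let ?g = "\<lambda>k. ((*v) B ^^ k) (real_vec (g k))"
  have [measurable]: "U \<in> sets borel" using assms by simp
  have "indicator U (t + s) \<le> (liminf (\<lambda>k. indicator U (t + ?g k)) :: ennreal)" for t
  proof (cases "t + s \<in> U")
    case True
    have "(\<lambda>k. t + ?g k) \<longlonglongrightarrow> t + s" by (intro tendsto_intros g)
    then have "\<forall>\<^sub>F k in sequentially. t + ?g k \<in> U"
      using assms True by (rule topological_tendstoD)
    then have "\<forall>\<^sub>F k in sequentially. 1 \<le> (indicator U (t + ?g k) :: ennreal)"
      by (rule eventually_mono) simp
    then have "1 \<le> (liminf (\<lambda>k. indicator U (t + ?g k)) :: ennreal)"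
      by (rule Liminf_bounded)
    with True show ?thesis by simp
  qed simp
  then have "(\<integral>\<^sup>+t. indicator U (t + s) \<partial>translates_measure)
      \<le> (\<integral>\<^sup>+t. liminf (\<lambda>k. indicator U (t + ?g k)) \<partial>translates_measure)"
    by (intro nn_integral_mono)
  also have "\<dots> \<le> liminf (\<lambda>k. \<integral>\<^sup>+t. indicator U (t + ?g k) \<partial>translates_measure)"
    by (rule nn_integral_liminf) measurable
  also have "\<dots> = liminf (\<lambda>k. \<integral>\<^sup>+t. indicator U t \<partial>translates_measure)"
    by (subst translates_measure_fine_shift) auto
  also have "\<dots> = (\<integral>\<^sup>+t. indicator U t \<partial>translates_measure)"
    by (rule Liminf_const) simp
  finally show ?thesis .
qed

lemma translates_measure_open_shift:
  assumes "open U"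
  shows "(\<integral>\<^sup>+t. indicator U (t + s) \<partial>translates_measure) = (\<integral>\<^sup>+t. indicator U t \<partial>translates_measure)"
proof (rule antisym)
  \<comment> \<open>The converse inequality is the same statement for the translated set and the opposite shift.\<close>
  let ?V = "(\<lambda>t. t + s) -` U"
  have "open ?V" by (intro open_vimage assms continuous_intros)
  from translates_measure_open_shift_le[OF this, of "- s"]
  show "(\<integral>\<^sup>+t. indicator U t \<partial>translates_measure) \<le> (\<integral>\<^sup>+t. indicator U (t + s) \<partial>translates_measure)"
    by (simp add: indicator_def)
qed (rule translates_measure_open_shift_le[OF assms])

definition unit_cell :: "(real ^ 'n) set" where
  "unit_cell = {t. \<forall>i. 0 \<le> t $ i \<and> t $ i < 1}"

lemma sets_unit_cell [measurable]: "unit_cell \<in> sets borel"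
proof -
  have "unit_cell = (\<Inter>i. {t. 0 \<le> t $ i} \<inter> {t. t $ i < 1})"
    by (auto simp: unit_cell_def)
  also have "\<dots> \<in> sets borel"
    by (intro sets.finite_INT sets.Int borel_closed borel_open closed_Collect_le open_Collect_less continuous_intros) auto
  finally show ?thesis .
qed

lemma emeasure_unit_cell: "emeasure lborel unit_cell = 1"
proof (rule antisym)
  let ?one = "(\<chi> i. 1) :: real ^ 'n"
  have "(?one - 0) \<bullet> b = 1" if "b \<in> Basis" for b :: "real ^ 'n"
    using that by (auto simp: Basis_vec_def inner_axis)
  then have 1: "emeasure lborel (box 0 ?one) = 1" "emeasure lborel (cbox 0 ?one) = 1"
    by (auto simp: emeasure_lborel_box_eq emeasure_lborel_cbox_eq)
  have "unit_cell \<subseteq> cbox 0 ?one" "box 0 ?one \<subseteq> unit_cell"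
    by (auto simp: unit_cell_def mem_box_cart less_imp_le)
  then have "emeasure lborel unit_cell \<le> emeasure lborel (cbox 0 ?one)"
    "emeasure lborel (box 0 ?one) \<le> emeasure lborel unit_cell"
    by (auto intro!: emeasure_mono)
  then show "emeasure lborel unit_cell \<le> 1" "1 \<le> emeasure lborel unit_cell"
    by (simp_all only: 1)
qed

lemma sum_translates_unit_cell:
  "(\<integral>\<^sup>+v. indicator unit_cell (t + real_vec v) \<partial>count_space UNIV) = 1"
proof -
  let ?v = "(\<chi> i. - \<lfloor>t $ i\<rfloor>) :: int ^ 'n"
  have "t + real_vec v \<in> unit_cell \<longleftrightarrow> v = ?v" for v
  proof -
    have "0 \<le> t $ i + of_int (v $ i) \<and> t $ i + of_int (v $ i) < 1 \<longleftrightarrow> v $ i = - \<lfloor>t $ i\<rfloor>" for i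
      by linarith
    then show ?thesis by (simp add: unit_cell_def real_vec_def vec_eq_iff)
  qed
  then have "(\<integral>\<^sup>+v. indicator unit_cell (t + real_vec v) \<partial>count_space UNIV)
      = (\<integral>\<^sup>+v. indicator {?v} v \<partial>count_space UNIV)"
    by (intro nn_integral_cong) (simp add: indicator_def)
  also have "\<dots> = 1" by simp
  finally show ?thesis .
qed

lemma nn_integral_lborel_shift:
  fixes f :: "real ^ 'n \<Rightarrow> ennreal"
  assumes [measurable]: "f \<in> borel_measurable borel"
  shows "(\<integral>\<^sup>+t. f (t + a) \<partial>lborel) = (\<integral>\<^sup>+t. f t \<partial>lborel)"
proof -
  have "(\<integral>\<^sup>+t. f t \<partial>lborel) = (\<integral>\<^sup>+t. f t \<partial>distr lborel borel ((+) a))"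
    by (simp only: lborel_distr_plus)
  also have "\<dots> = (\<integral>\<^sup>+t. f (a + t) \<partial>lborel)" by (rule nn_integral_distr) auto
  finally show ?thesis by (simp add: add.commute)
qed

text \<open>Averaging all shifts over a unit cell turns the sum over integer translates into an integral over
  the whole space. For each digit sequence that integral is the Lebesgue integral of \<open>f\<close>, independently
  of the sequence, and the digit distribution has total mass one.\<close>

lemma translates_measure_average:
  assumes f [measurable]: "f \<in> borel_measurable borel"
  shows "(\<integral>\<^sup>+s. indicator unit_cell s * (\<integral>\<^sup>+t. f (t + s) \<partial>translates_measure) \<partial>lborel)
    = (\<integral>\<^sup>+t. f t \<partial>lborel)"
proof -
  let ?Q = "indicator unit_cell :: real ^ 'n \<Rightarrow> ennreal"
  let ?F = "\<lambda>s v x. ?Q s * f (value_of x - real_vec v + s)"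
  have "(\<integral>\<^sup>+s. ?Q s * (\<integral>\<^sup>+t. f (t + s) \<partial>translates_measure) \<partial>lborel)
      = (\<integral>\<^sup>+s. \<integral>\<^sup>+v. \<integral>\<^sup>+x. ?F s v x \<partial>\<mu> \<partial>count_space UNIV \<partial>lborel)"
    by (simp add: nn_integral_translates_measure nn_integral_cmult)
  also have "\<dots> = (\<integral>\<^sup>+v. \<integral>\<^sup>+s. \<integral>\<^sup>+x. ?F s v x \<partial>\<mu> \<partial>lborel \<partial>count_space UNIV)"
    by (rule nn_integral_count_space_nn_integral) (auto, measurable)
  also have "\<dots> = (\<integral>\<^sup>+v. \<integral>\<^sup>+x. \<integral>\<^sup>+s. ?F s v x \<partial>lborel \<partial>\<mu> \<partial>count_space UNIV)"
    by (intro nn_integral_cong fubini.Fubini'[symmetric]) measurable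
  also have "\<dots> = (\<integral>\<^sup>+v. \<integral>\<^sup>+x. \<integral>\<^sup>+s. ?Q (s - value_of x + real_vec v) * f s \<partial>lborel \<partial>\<mu> \<partial>count_space UNIV)"
  proof (rule nn_integral_cong, rule nn_integral_cong)
    fix v x
    have "(\<integral>\<^sup>+s. ?F (s + (real_vec v - value_of x)) v x \<partial>lborel) = (\<integral>\<^sup>+s. ?F s v x \<partial>lborel)"
      by (rule nn_integral_lborel_shift) measurable
    then show "(\<integral>\<^sup>+s. ?F s v x \<partial>lborel) = (\<integral>\<^sup>+s. ?Q (s - value_of x + real_vec v) * f s \<partial>lborel)"
      by (simp add: algebra_simps)
  qed
  also have "\<dots> = (\<integral>\<^sup>+x. \<integral>\<^sup>+v. \<integral>\<^sup>+s. ?Q (s - value_of x + real_vec v) * f s \<partial>lborel \<partial>count_space UNIV \<partial>\<mu>)"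
    by (rule nn_integral_count_space_nn_integral[symmetric]) (auto, measurable)
  also have "\<dots> = (\<integral>\<^sup>+x. \<integral>\<^sup>+s. \<integral>\<^sup>+v. ?Q (s - value_of x + real_vec v) * f s \<partial>count_space UNIV \<partial>lborel \<partial>\<mu>)"
    by (intro nn_integral_cong nn_integral_count_space_nn_integral[symmetric]) auto
  also have "\<dots> = (\<integral>\<^sup>+x. \<integral>\<^sup>+s. f s \<partial>lborel \<partial>\<mu>)"
    by (simp add: nn_integral_multc sum_translates_unit_cell)
  also have "\<dots> = (\<integral>\<^sup>+s. f s \<partial>lborel)"
    by (simp add: digits_space.emeasure_space_1)
  finally show ?thesis .
qed

lemma emeasure_translates_measure_open:
  assumes "open U"
  shows "emeasure translates_measure U = emeasure lborel U"
proof -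
  have [measurable]: "U \<in> sets borel" using assms by simp
  have "emeasure lborel U = (\<integral>\<^sup>+t. indicator U t \<partial>lborel)" by simp
  also have "\<dots> = (\<integral>\<^sup>+s. indicator unit_cell s * (\<integral>\<^sup>+t. indicator U (t + s) \<partial>translates_measure) \<partial>lborel)"
    by (rule translates_measure_average[symmetric]) simp
  also have "\<dots> = (\<integral>\<^sup>+s. indicator unit_cell s * emeasure translates_measure U \<partial>lborel)"
    by (simp add: translates_measure_open_shift[OF assms])
  also have "\<dots> = emeasure translates_measure U"
    by (simp add: nn_integral_multc emeasure_unit_cell)
  finally show ?thesis ..
qed

text \<open>On open sets the shifts do not change the mass, so the average over the unit cell is the mass
  itself; and agreement on boxes suffices.\<close>

theorem translates_measure_eq_lborel: "translates_measure = lborel"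
proof (rule lborel_eqI[symmetric])
  fix l u :: "real ^ 'n" assume "\<And>b. b \<in> Basis \<Longrightarrow> l \<bullet> b \<le> u \<bullet> b"
  then show "emeasure translates_measure (box l u) = (\<Prod>b\<in>Basis. (u - l) \<bullet> b)"
    by (simp only: emeasure_translates_measure_open[OF open_box] emeasure_lborel_box)
qed simp

corollary emeasure_lborel_eq_sum_translates:
  assumes [measurable]: "T \<in> sets borel"
  shows "emeasure lborel T
    = (\<integral>\<^sup>+v. emeasure \<mu> {x \<in> space \<mu>. value_of x - real_vec v \<in> T} \<partial>count_space UNIV)"
proof -
  have "emeasure lborel T = (\<integral>\<^sup>+t. indicator T t \<partial>translates_measure)"
    by (simp add: translates_measure_eq_lborel)
  also have "\<dots> = (\<integral>\<^sup>+v. \<integral>\<^sup>+x. indicator T (value_of x - real_vec v) \<partial>\<mu> \<partial>count_space UNIV)"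
    by (rule nn_integral_translates_measure) simp
  also have "\<dots> = (\<integral>\<^sup>+v. emeasure \<mu> {x \<in> space \<mu>. value_of x - real_vec v \<in> T} \<partial>count_space UNIV)"
  proof (intro nn_integral_cong)
    fix v
    have "(\<integral>\<^sup>+x. indicator T (value_of x - real_vec v) \<partial>\<mu>)
        = (\<integral>\<^sup>+x. indicator {x \<in> space \<mu>. value_of x - real_vec v \<in> T} x \<partial>\<mu>)"
      by (intro nn_integral_cong) (simp add: indicator_def)
    also have "\<dots> = emeasure \<mu> {x \<in> space \<mu>. value_of x - real_vec v \<in> T}"
      by (rule nn_integral_indicator) measurable
    finally show "(\<integral>\<^sup>+x. indicator T (value_of x - real_vec v) \<partial>\<mu>)
        = emeasure \<mu> {x \<in> space \<mu>. value_of x - real_vec v \<in> T}" .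
  qed
  finally show ?thesis .
qed

end

section \<open>The measure of the intersection\<close>

context digit_system
begin

theorem emeasure_expansions_Int:
  assumes E: "finite E" "C \<subseteq> E" "D\<^sub>1 \<subseteq> E" "D\<^sub>2 \<subseteq> E"
  shows "emeasure lborel (expansions (real_vec ` D\<^sub>1) \<inter> expansions (real_vec ` D\<^sub>2)) =
    (\<Sum>v\<in>verts (nucleus (Gamma_graph A E)).
       emeasure \<mu>
         (left_infinite_labels (restrict_labels (nucleus (Gamma_graph A E)) C D\<^sub>1) v \<inter>
          left_infinite_labels (restrict_labels (nucleus (Gamma_graph A E)) C D\<^sub>2) v))"
proof -
  let ?N = "nucleus (Gamma_graph A E)"
  let ?F = "\<lambda>D v. left_infinite_labels (restrict_labels ?N C D) v"
  let ?T = "expansions (real_vec ` D\<^sub>1) \<inter> expansions (real_vec ` D\<^sub>2)"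
  have "finite D\<^sub>1" "finite D\<^sub>2" using E by (auto intro: finite_subset)
  then have T: "?T \<in> sets borel"
    by (intro sets.Int borel_compact compact_expansions finite_imp_compact finite_imageI)
  have "{x \<in> space \<mu>. value_of x - real_vec v \<in> ?T} = ?F D\<^sub>1 v \<inter> ?F D\<^sub>2 v" for v
    using left_infinite_labels_nucleus[OF E(1,2,3), of _ v]
      left_infinite_labels_nucleus[OF E(1,2,4), of _ v]
    by (auto simp: space_digits)
  then have "emeasure lborel ?T = (\<integral>\<^sup>+v. emeasure \<mu> (?F D\<^sub>1 v \<inter> ?F D\<^sub>2 v) \<partial>count_space UNIV)"
    by (simp add: emeasure_lborel_eq_sum_translates[OF T])
  also have "\<dots> = (\<Sum>v\<in>verts ?N. emeasure \<mu> (?F D\<^sub>1 v \<inter> ?F D\<^sub>2 v))"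
  \<comment> \<open>Translates by vectors outside the nucleus contribute nothing, so the sum over \<open>\<int>\<^sup>n\<close> is finite.\<close>
  proof (rule nn_integral_count_space'[OF finite_nucleus[OF E(1)]])
    fix v assume v: "v \<notin> verts ?N"
    have "?F D\<^sub>1 v = {}"
    proof (rule ccontr)
      assume "?F D\<^sub>1 v \<noteq> {}"
      then obtain x w where "w 0 = v" "\<forall>k. (w (Suc k), x k, w k) \<in> arcs (restrict_labels ?N C D\<^sub>1)"
        by (auto simp: left_infinite_labels_def)
      then have "(w (Suc 0), x 0, v) \<in> arcs (restrict_labels ?N C D\<^sub>1)" by metis
      then have "v \<in> verts ?N"
        by (auto simp: restrict_labels_def labeled_digraph_def nucleus_def induce_subgraph_def
            head_Gamma_graph)
      with v show False by contradiction
    qed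
    then show "emeasure \<mu> (?F D\<^sub>1 v \<inter> ?F D\<^sub>2 v) = 0" by simp
  qed simp
  finally show ?thesis .
qed

end

theorem mainTheorem3:
  fixes A :: "int ^ 'n ^ 'n"
    and D\<^sub>1 D\<^sub>2 C E :: "(int ^ 'n) set"
  assumes "expanding A"
    and "finite D\<^sub>1" "D\<^sub>1 \<noteq> {}"
    and "finite D\<^sub>2" "D\<^sub>2 \<noteq> {}"
    and "D\<^sub>1 \<noteq> D\<^sub>2"
    and "finite E" "D\<^sub>1 \<subseteq> E" "D\<^sub>2 \<subseteq> E"
    and "coset_transversal A C" "C \<subseteq> E"
  shows "emeasure lebesgue (self_affine_set A D\<^sub>1 \<inter> self_affine_set A D\<^sub>2) =
    (\<Sum>v\<in>verts (nucleus (Gamma_graph A E)).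
       emeasure (bernoulli_measure C)
         (left_infinite_labels (restrict_labels (nucleus (Gamma_graph A E)) C D\<^sub>1) v \<inter>
          left_infinite_labels (restrict_labels (nucleus (Gamma_graph A E)) C D\<^sub>2) v))"
proof (rule expanding_inverse_contracts[OF assms(1)])
  fix B :: "real ^ 'n ^ 'n" and K r
  assume B: "map_matrix real_of_int A ** B = mat 1" "B ** map_matrix real_of_int A = mat 1"
    "0 \<le> r" "r < 1" "\<And>k x. norm (((*v) B ^^ k) x) \<le> K * r ^ k * norm x"
  interpret digit_system A B K r C
    using B assms(7,10,11) by unfold_locales (auto intro: finite_subset)
  have "expansions (real_vec ` D\<^sub>1) \<inter> expansions (real_vec ` D\<^sub>2) \<in> sets borel"
    using assms(2,4)
    by (intro sets.Int borel_compact compact_expansions finite_imp_compact finite_imageI)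
  then have "emeasure lebesgue (self_affine_set A D\<^sub>1 \<inter> self_affine_set A D\<^sub>2)
      = emeasure lborel (expansions (real_vec ` D\<^sub>1) \<inter> expansions (real_vec ` D\<^sub>2))"
    using assms(2-5) by (simp add: self_affine_set_eq_expansions emeasure_completion)
  also have "\<dots> = (\<Sum>v\<in>verts (nucleus (Gamma_graph A E)).
       emeasure (bernoulli_measure C)
         (left_infinite_labels (restrict_labels (nucleus (Gamma_graph A E)) C D\<^sub>1) v \<inter>
          left_infinite_labels (restrict_labels (nucleus (Gamma_graph A E)) C D\<^sub>2) v))"
    by (rule emeasure_expansions_Int) (use assms in auto)
  finally show ?thesis .
qed

end
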